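(* Let $\sigma>0$. There is $r_0>0$ (depending on $\sigma$ and on the physical constants) such that for every real number $\rho^{\rm el}(0)$ with $0<\rho^{\rm el}(0)\le r_0$ the following holds. Put $\rho^{\rm el}({\bf k})=\rho^{\rm el}(0)\exp(-|{\bf k}|^2/2\sigma^2)$ for ${\bf k}\in\mathbb R^3$. Then there exist properly normalized wave functions $\psi=(\psi_{{\bf k}^{\rm ph},{\bf k}})$ of the coupled photon field and electron field such that $$\langle \hat H^{\rm ph}\rangle+\langle\hat H^{\rm I}\rangle<0$$ and, for all ${\bf k}\in\mathbb R^3$, $$l^3\int_{\mathbb R^3}{\rm d}{\bf k}^{\rm ph}\,\langle\psi_{{\bf k}^{\rm ph},{\bf k}}|\hat H^{\rm el}\psi_{{\bf k}^{\rm ph},{\bf k}}\rangle=\rho^{\rm el}({\bf k})\,\hbar\omega({\bf k}).$$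
   Context: Constants: $\hbar,c,\kappa,l,\lambda>0$ and $q\neq0$ real are fixed. The electron dispersion is $\omega({\bf k})=c\sqrt{\kappa^2+|{\bf k}|^2}$. State space (reducible QED). ${\cal F}^{\rm ph}$ is the two-mode boson Fock space with orthonormal basis $|m,n\rangle$, $m,n=0,1,2,\dots$, and annihilation operators $\hat a_H,\hat a_V$ with $\hat a_H|m,n\rangle=\sqrt m\,|m-1,n\rangle$, $\hat a_V|m,n\rangle=\sqrt n\,|m,n-1\rangle$. ${\cal F}^{\rm el}$ is the 16-dimensional Fock space of four fermionic modes, with annihilation operators $\hat\phi^{(+)}_s$ and creation operators $\hat\phi^{(-)}_s=(\hat\phi^{(+)}_s)^\dagger$, $s=1,2,3,4$, satisfying $\{\hat\phi^{(+)}_s,\hat\phi^{(-)}_t\}=\delta_{s,t}$, $\{\hat\phi^{(+)}_s,\hat\phi^{(+)}_t\}=0$, and vacuum $|\emptyset\rangle$. Modes $s=1,2$ are electrons with spin up/down, $s=3,4$ are positrons. A wave function is a measurable map $({\bf k}^{\rm ph},{\bf k})\in\mathbb R^3\times\mathbb R^3\mapsto\psi_{{\bf k}^{\rm ph},{\bf k}}\in{\cal F}^{\rm ph}\otimes{\cal F}^{\rm el}$. It is properly normalized if $\|\psi_{{\bf k}^{\rm ph},{\bf k}}\|=1$ for all ${\bf k}^{\rm ph},{\bf k}$. The expectation of an operator $\hat X$ is $$\langle\hat X\rangle=l^6\int{\rm d}{\bf k}^{\rm ph}\int{\rm d}{\bf k}\,\langle\psi_{{\bf k}^{\rm ph},{\bf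 k}}|(\hat X\psi)_{{\bf k}^{\rm ph},{\bf k}}\rangle,$$ and the wave functions considered are those for which the expectations involved are well defined and finite. Free Hamiltonians (acting pointwise in $({\bf k}^{\rm ph},{\bf k})$): $$\hat H^{\rm ph}=\hbar c|{\bf k}^{\rm ph}|(\hat a_H^\dagger\hat a_H+\hat a_V^\dagger\hat a_V),\qquad \hat H^{\rm el}=\hbar\omega({\bf k})\sum_{s=1}^4\hat\phi^{(-)}_s\hat\phi^{(+)}_s.$$ Photon field. For ${\bf k}^{\rm ph}\ne0$ let $\varepsilon^{(H)}({\bf k}^{\rm ph}),\varepsilon^{(V)}({\bf k}^{\rm ph})\in\mathbb R^3$ be fixed real orthonormal polarization vectors, both orthogonal to ${\bf k}^{\rm ph}$, with $\varepsilon^{(H)}(-{\bf k}^{\rm ph})=\varepsilon^{(H)}({\bf k}^{\rm ph})$ and $\varepsilon^{(V)}(-{\bf k}^{\rm ph})=-\varepsilon^{(V)}({\bf k}^{\rm ph})$. At time $0$ the vector potential operators are $\hat A_0=0$ and, for $\alpha=1,2,3$, $$\hat A_{\alpha,{\bf k}^{\rm ph}}({\bf x},0)=\tfrac12\lambda\varepsilon^{(H)}_\alpha({\bf k}^{\rm ph})\left[e^{i{\bf k}^{\rm ph}\cdot{\bf x}}\hat a_H+e^{-i{\bf k}^{\rm ph}\cdot{\bf x}}\hat a_H^\dagger\right]+\tfrac12\lambda\varepsilon^{(V)}_\alpha({\bf k}^{\rm ph})\left[e^{i{\bf k}^{\rm ph}\cdot{\bf x}}\hat a_V+e^{-i{\bf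 k}^{\rm ph}\cdot{\bf x}}\hat a_V^\dagger\right].$$ Electron field. $\gamma^\mu$ are the Dirac matrices in the standard (Dirac) representation and $\sigma_1,\sigma_2,\sigma_3$ are the Pauli matrices (with $\vec\sigma\cdot{\bf k}=\sum_\alpha\sigma_\alpha k_\alpha$). With $\chi_1=(1,0)^T$, $\chi_2=(0,1)^T$, the spinors are $$u^{(s)}({\bf k})=\frac{1}{\sqrt{\omega({\bf k})[\omega({\bf k})+c\kappa]}}\begin{pmatrix}[\omega({\bf k})+c\kappa]\chi_s\\ c\,(\vec\sigma\cdot{\bf k})\chi_s\end{pmatrix}\quad(s=1,2),\qquad v^{(s+2)}({\bf k})=i\gamma^2\,\overline{u^{(s)}({\bf k})}\quad(s=1,2).$$ At time $0$, $\hat\phi^{(\pm)}_{s,{\bf k}}({\bf x},0)=e^{\pm i{\bf k}\cdot{\bf x}}\hat\phi^{(\pm)}_s$, and for $r=1,\dots,4$ $$\hat\psi_{r,{\bf k}}({\bf x},0)=\sum_{s=1,2}u^{(s)}_r({\bf k})\hat\phi^{(+)}_{s,{\bf k}}({\bf x},0)+\sum_{s=3,4}v^{(s)}_r({\bf k})\hat\phi^{(-)}_{s,{\bf k}}({\bf x},0),$$ with Dirac adjoint $\hat\psi^{\rm a}_{r,{\bf k}}=\sum_{r'}\hat\psi_{r',{\bf k}}^\dagger\gamma^0_{r',r}$. The operators $\hat J^\mu$ acting on ${\cal F}^{\rm el}$ are $$\hat J^\mu_{{\bf k},{\bf k}'}({\bf x},0)=\tfrac12\sum_{r,r'}\gamma^\mu_{r,r'}\hat\psi^{\rm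 a}_{r,{\bf k}}({\bf x},0)\hat\psi_{r',{\bf k}'}({\bf x},0)-\tfrac12\sum_{r,r'}\gamma^\mu_{r',r}\hat\psi_{r,{\bf k}}({\bf x},0)\hat\psi^{\rm a}_{r',{\bf k}'}({\bf x},0).$$ Interaction Hamiltonian: $$(\hat H^{\rm I}\psi)_{{\bf k}^{\rm ph},{\bf k}}=\frac{qc}{(2\pi)^3}\int_{\mathbb R^3}{\rm d}{\bf x}\int_{\mathbb R^3}{\rm d}{\bf k}'\sum_{\alpha=1}^3\hat A_{\alpha,{\bf k}^{\rm ph}}({\bf x},0)\,\hat J^\alpha_{{\bf k},{\bf k}'}({\bf x},0)\,\psi_{{\bf k}^{\rm ph},{\bf k}'},$$ where the ${\bf x}$-integration is understood in the usual sense $(2\pi)^{-3}\int{\rm d}{\bf x}\,e^{i{\bf p}\cdot{\bf x}}=\delta({\bf p})$, so that ${\bf k}'$ is fixed in terms of ${\bf k}$ and ${\bf k}^{\rm ph}$ in each term. *)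

theory Defs
  imports "HOL-Analysis.Analysis"
begin

lemma vector_4 [simp]:
  "(vector [a, b, c, d] :: 'a::zero ^ 4) $ 1 = a"
  "(vector [a, b, c, d] :: 'a::zero ^ 4) $ 2 = b"
  "(vector [a, b, c, d] :: 'a::zero ^ 4) $ 3 = c"
  "(vector [a, b, c, d] :: 'a::zero ^ 4) $ 4 = d"
  unfolding vector_def by simp_all

definition cscale :: "complex \<Rightarrow> complex ^ 'n ^ 'm \<Rightarrow> complex ^ 'n ^ 'm"  (infixr "*\<^sub>M" 70)
  where "a *\<^sub>M M = (\<chi> i j. a * M $ i $ j)"

definition dagger :: "complex ^ 'n ^ 'm \<Rightarrow> complex ^ 'm ^ 'n"
  where "dagger M = (\<chi> i j. cnj (M $ j $ i))"

definition vec_cnj :: "complex ^ 'n \<Rightarrow> complex ^ 'n"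
  where "vec_cnj v = (\<chi> i. cnj (v $ i))"

definition cinner :: "complex ^ 'n \<Rightarrow> complex ^ 'n \<Rightarrow> complex"
  where "cinner v w = (\<Sum>i\<in>UNIV. cnj (v $ i) * w $ i)"

text \<open>
  The fermionic Fock space is \<open>complex ^ (4 set)\<close>: the coordinate \<open>S\<close> is the amplitude of the
  configuration in which exactly the modes in \<open>S\<close> are occupied, so \<open>axis {} 1\<close> is the vacuum.
  The type \<open>4\<close> consists of \<open>1\<close>, \<open>2\<close>, \<open>3\<close> and \<open>4 = 0\<close>; it is linearly ordered (with
  \<open>4\<close> as least element), and this order only fixes the signs of the basis vectors in the
  Jordan-Wigner representation of the canonical anticommutation relations (\<open>phi_CAR\<close> below).
\<close>

type_synonym fermi = "complex ^ (4 set)"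
type_synonym fermi_op = "complex ^ (4 set) ^ (4 set)"

definition jw_sign :: "4 \<Rightarrow> 4 set \<Rightarrow> complex"
  where "jw_sign s S = (-1) ^ card {t \<in> S. t < s}"

definition phi :: "4 \<Rightarrow> fermi_op"
  where "phi s = (\<chi> S T. if s \<notin> S \<and> T = insert s S then jw_sign s S else 0)"

definition phi_dag :: "4 \<Rightarrow> fermi_op"
  where "phi_dag s = dagger (phi s)"

text \<open>
  An element of the tensor product of the two-mode photon Fock space with the fermionic Fock space
  is given by its components along \<open>|m,n\<rangle>\<close>.  The photon operators are not everywhere defined on
  \<open>fock_space\<close>; they are extended to arbitrary families of components, and membership of the result
  in \<open>fock_space\<close> expresses that the argument lies in the domain.
\<close>

type_synonym fock = "nat \<times> nat \<Rightarrow> fermi"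

definition fock_space :: "fock set"
  where "fock_space = {\<Psi>. (\<lambda>p. (norm (\<Psi> p))\<^sup>2) summable_on UNIV}"

definition fock_norm :: "fock \<Rightarrow> real"
  where "fock_norm \<Psi> = sqrt (\<Sum>\<^sub>\<infinity>p. (norm (\<Psi> p))\<^sup>2)"

definition fock_inner :: "fock \<Rightarrow> fock \<Rightarrow> complex"
  where "fock_inner \<Psi> \<Phi> = (\<Sum>\<^sub>\<infinity>p. cinner (\<Psi> p) (\<Phi> p))"

definition ket :: "nat \<Rightarrow> nat \<Rightarrow> fermi \<Rightarrow> fock"
  where "ket m n v = (\<lambda>p. if p = (m, n) then v else 0)"

definition a_H :: "fock \<Rightarrow> fock"
  where "a_H \<Psi> = (\<lambda>(m, n). sqrt (real (m + 1)) *\<^sub>R \<Psi> (m + 1, n))"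

definition a_V :: "fock \<Rightarrow> fock"
  where "a_V \<Psi> = (\<lambda>(m, n). sqrt (real (n + 1)) *\<^sub>R \<Psi> (m, n + 1))"

definition a_H_dag :: "fock \<Rightarrow> fock"
  where "a_H_dag \<Psi> = (\<lambda>(m, n). sqrt (real m) *\<^sub>R \<Psi> (m - 1, n))"

definition a_V_dag :: "fock \<Rightarrow> fock"
  where "a_V_dag \<Psi> = (\<lambda>(m, n). sqrt (real n) *\<^sub>R \<Psi> (m, n - 1))"

lemma a_ket:
  "a_H (ket m n v) = ket (m - 1) n (sqrt (real m) *\<^sub>R v)"
  "a_V (ket m n v) = ket m (n - 1) (sqrt (real n) *\<^sub>R v)"
  "a_H_dag (ket m n v) = ket (m + 1) n (sqrt (real (m + 1)) *\<^sub>R v)"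
  "a_V_dag (ket m n v) = ket m (n + 1) (sqrt (real (n + 1)) *\<^sub>R v)"
  by (auto simp: ket_def a_H_def a_V_def a_H_dag_def a_V_dag_def fun_eq_iff)

lemma jw_sign_insert:
  "t \<notin> S \<Longrightarrow> jw_sign s (insert t S) = (if t < s then - jw_sign s S else jw_sign s S)"
proof -
  assume t: "t \<notin> S"
  have "{u \<in> insert t S. u < s} = (if t < s then insert t {u \<in> S. u < s} else {u \<in> S. u < s})"
    by auto
  then show ?thesis using t by (simp add: jw_sign_def)
qed

lemma jw_sign_same: "jw_sign s (insert s S) = jw_sign s S" "jw_sign s (S - {s}) = jw_sign s S"
  by (auto simp: jw_sign_def intro!: arg_cong[of _ _ card] arg_cong2[of _ _ _ _ "(^)"])

lemma jw_sign_square: "jw_sign s S * jw_sign s S = 1"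
  by (simp add: jw_sign_def flip: power_add mult_2)

lemma phi_nth: "phi s $ S $ T = (if s \<notin> S \<and> T = insert s S then jw_sign s S else 0)"
  by (simp add: phi_def)

lemma phi_dag_nth: "phi_dag s $ S $ T = (if s \<notin> T \<and> S = insert s T then jw_sign s T else 0)"
  by (simp add: phi_dag_def dagger_def phi_def jw_sign_def)

lemma phi_mult_nth:
  "(phi s ** M) $ S $ T = (if s \<in> S then 0 else jw_sign s S * M $ insert s S $ T)"
proof -
  have "phi s $ S $ U * M $ U $ T = (if U = insert s S then
      (if s \<in> S then 0 else jw_sign s S * M $ insert s S $ T) else 0)" for U
    by (simp add: phi_nth)
  then show ?thesis by (simp add: matrix_matrix_mult_def)
qed

lemma phi_dag_mult_nth:
  "(phi_dag s ** M) $ S $ T = (if s \<in> S then jw_sign s S * M $ (S - {s}) $ T else 0)"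
proof -
  have *: "s \<notin> U \<and> S = insert s U \<longleftrightarrow> s \<in> S \<and> U = S - {s}" for U by auto
  have "phi_dag s $ S $ U * M $ U $ T = (if U = S - {s} then
      (if s \<in> S then jw_sign s S * M $ (S - {s}) $ T else 0) else 0)" for U
    unfolding phi_dag_nth * by (simp add: jw_sign_same)
  then show ?thesis by (simp add: matrix_matrix_mult_def)
qed

lemma phi_CAR:
  "phi s ** phi_dag t + phi_dag t ** phi s = (if s = t then mat 1 else 0)"
  "phi s ** phi t + phi t ** phi s = 0"
proof -
  have "(phi s ** phi_dag t + phi_dag t ** phi s) $ S $ T =
      (if s = t then mat 1 else 0) $ S $ T" for S T
  proof (cases "s = t")
    case True
    show ?thesis
    proof (cases "t \<in> S")
      case t: True
      then have "insert t (S - {t}) = S" by blast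
      then have "(phi s ** phi_dag t + phi_dag t ** phi s) $ S $ T = (if T = S then 1 else 0)"
        using True t by (simp add: phi_mult_nth phi_dag_mult_nth phi_nth jw_sign_same jw_sign_square)
      then show ?thesis using True by (simp add: mat_def)
    next
      case t: False
      then have "t \<notin> T \<and> insert t S = insert t T \<longleftrightarrow> T = S" using insert_ident by metis
      then have "(phi s ** phi_dag t + phi_dag t ** phi s) $ S $ T = (if T = S then 1 else 0)"
        using True t by (simp add: phi_mult_nth phi_dag_mult_nth phi_dag_nth jw_sign_square)
      then show ?thesis using True by (simp add: mat_def)
    qed
  next
    case st: False
    show ?thesis
    proof (cases "s \<notin> S \<and> t \<in> S")
      case True
      then obtain R where R: "S = insert t R" "t \<notin> R" by (meson Set.set_insert)
      with True have R': "s \<notin> R" by auto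
      have 1: "t \<notin> T \<and> insert s S = insert t T \<longleftrightarrow> T = insert s R"
        using R R' st by (auto simp: insert_commute)
      have 2: "S - {t} = R" using R by auto
      have "(phi s ** phi_dag t + phi_dag t ** phi s) $ S $ T =
        (if T = insert s R then jw_sign s S * jw_sign t T + jw_sign t S * jw_sign s R else 0)"
        using True R' by (simp add: phi_mult_nth phi_dag_mult_nth phi_nth phi_dag_nth 1 2)
      also have "\<dots> = 0"
        using R(2) R' st less_asym[of s t] less_linear[of s t] unfolding R(1)
        by (auto simp: jw_sign_insert)
      finally show ?thesis using st by simp
    next
      case False
      have "t \<notin> T \<Longrightarrow> insert s S = insert t T \<Longrightarrow> t \<in> S"
        using st by (metis insertE insertI1)
      then have "(phi s ** phi_dag t) $ S $ T = 0"
        using False by (cases "s \<in> S") (auto simp only: phi_mult_nth phi_dag_nth if_True if_False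
          mult_zero_right split: if_splits)
      moreover have "(phi_dag t ** phi s) $ S $ T = 0"
        using False st by (cases "t \<in> S") (simp_all add: phi_dag_mult_nth phi_nth)
      ultimately show ?thesis using st by simp
    qed
  qed
  then show "phi s ** phi_dag t + phi_dag t ** phi s = (if s = t then mat 1 else 0)"
    by (simp add: vec_eq_iff)
  have "(phi s ** phi t + phi t ** phi s) $ S $ T = 0" for S T
  proof (cases "s \<notin> S \<and> t \<notin> S \<and> s \<noteq> t")
    case True
    then have "jw_sign s S * jw_sign t (insert s S) + jw_sign t S * jw_sign s (insert t S) = 0"
      using less_asym[of s t] less_linear[of s t] by (auto simp: jw_sign_insert)
    then show ?thesis using True
      by (auto simp: phi_mult_nth phi_nth insert_commute[of t s])
  next
    case False
    then show ?thesis by (simp add: phi_mult_nth phi_nth) blast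
  qed
  then show "phi s ** phi t + phi t ** phi s = 0" by (simp add: vec_eq_iff)
qed

text \<open>The first argument is the photon wave vector, the second the electron wave vector.\<close>

type_synonym wave = "real ^ 3 \<Rightarrow> real ^ 3 \<Rightarrow> fock"

definition wave_function :: "wave \<Rightarrow> bool"
  where "wave_function \<psi> \<longleftrightarrow>
    (\<forall>p. (\<lambda>z. \<psi> (fst z) (snd z) p) \<in> borel_measurable borel) \<and>
    (\<forall>kph k. \<psi> kph k \<in> fock_space)"

definition properly_normalized :: "wave \<Rightarrow> bool"
  where "properly_normalized \<psi> \<longleftrightarrow> (\<forall>kph k. fock_norm (\<psi> kph k) = 1)"

definition expectation :: "real \<Rightarrow> (wave \<Rightarrow> wave) \<Rightarrow> wave \<Rightarrow> complex"
  where "expectation l X \<psi> = complex_of_real (l ^ 6) *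
    (\<integral>kph. (\<integral>k. fock_inner (\<psi> kph k) (X \<psi> kph k) \<partial>lborel) \<partial>lborel)"

definition expectation_defined :: "(wave \<Rightarrow> wave) \<Rightarrow> wave \<Rightarrow> bool"
  where "expectation_defined X \<psi> \<longleftrightarrow>
    (\<forall>kph k. X \<psi> kph k \<in> fock_space) \<and>
    integrable (lborel \<Otimes>\<^sub>M lborel) (\<lambda>(kph, k). fock_inner (\<psi> kph k) (X \<psi> kph k))"

definition omega :: "real \<Rightarrow> real \<Rightarrow> real ^ 3 \<Rightarrow> real"
  where "omega c \<kappa> k = c * sqrt (\<kappa>\<^sup>2 + (norm k)\<^sup>2)"

definition H_ph :: "real \<Rightarrow> real \<Rightarrow> wave \<Rightarrow> wave"
  where "H_ph hbar c \<psi> kph k = (\<lambda>p. (hbar * c * norm kph) *\<^sub>R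
    (a_H_dag (a_H (\<psi> kph k)) p + a_V_dag (a_V (\<psi> kph k)) p))"

definition H_el :: "real \<Rightarrow> real \<Rightarrow> real \<Rightarrow> wave \<Rightarrow> wave"
  where "H_el hbar c \<kappa> \<psi> kph k = (\<lambda>p. (hbar * omega c \<kappa> k) *\<^sub>R
    ((\<Sum>s\<in>UNIV. phi_dag s ** phi s) *v \<psi> kph k p))"

text \<open>
  The Borel measurability of the polarization vectors is implicit in
  the use of integrals over the photon wave vector.
\<close>

definition polarization :: "(real ^ 3 \<Rightarrow> real ^ 3) \<Rightarrow> (real ^ 3 \<Rightarrow> real ^ 3) \<Rightarrow> bool"
  where "polarization \<epsilon>H \<epsilon>V \<longleftrightarrow>
    \<epsilon>H \<in> borel_measurable borel \<and> \<epsilon>V \<in> borel_measurable borel \<and>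
    (\<forall>k. k \<noteq> 0 \<longrightarrow>
      norm (\<epsilon>H k) = 1 \<and> norm (\<epsilon>V k) = 1 \<and> \<epsilon>H k \<bullet> \<epsilon>V k = 0 \<and>
      \<epsilon>H k \<bullet> k = 0 \<and> \<epsilon>V k \<bullet> k = 0 \<and>
      \<epsilon>H (- k) = \<epsilon>H k \<and> \<epsilon>V (- k) = - \<epsilon>V k)"

definition A_field ::
  "real \<Rightarrow> (real ^ 3 \<Rightarrow> real ^ 3) \<Rightarrow> (real ^ 3 \<Rightarrow> real ^ 3) \<Rightarrow> 3 \<Rightarrow> real ^ 3 \<Rightarrow> real ^ 3 \<Rightarrow> fock \<Rightarrow> fock"
  where "A_field lam \<epsilon>H \<epsilon>V \<alpha> kph x \<Psi> = (\<lambda>p.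
    complex_of_real (lam / 2 * \<epsilon>H kph $ \<alpha>) *s
      (cis (kph \<bullet> x) *s a_H \<Psi> p + cis (- (kph \<bullet> x)) *s a_H_dag \<Psi> p) +
    complex_of_real (lam / 2 * \<epsilon>V kph $ \<alpha>) *s
      (cis (kph \<bullet> x) *s a_V \<Psi> p + cis (- (kph \<bullet> x)) *s a_V_dag \<Psi> p))"

text \<open>All fields are taken at time zero; \<open>gamma0\<close> and \<open>gamma 1\<close>, \<open>gamma 2\<close>, \<open>gamma 3\<close> are the Dirac matrices.\<close>

definition pauli :: "3 \<Rightarrow> complex ^ 2 ^ 2"
  where "pauli \<alpha> =
    (if \<alpha> = 1 then vector [vector [0, 1], vector [1, 0]]
     else if \<alpha> = 2 then vector [vector [0, - \<i>], vector [\<i>, 0]]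
     else vector [vector [1, 0], vector [0, - 1]])"

definition gamma0 :: "complex ^ 4 ^ 4"
  where "gamma0 = vector [
    vector [1, 0,  0,  0],
    vector [0, 1,  0,  0],
    vector [0, 0, -1,  0],
    vector [0, 0,  0, -1]]"

definition gamma :: "3 \<Rightarrow> complex ^ 4 ^ 4"
  where "gamma \<alpha> =
    (if \<alpha> = 1 then vector [
       vector [ 0,  0, 0, 1],
       vector [ 0,  0, 1, 0],
       vector [ 0, -1, 0, 0],
       vector [-1,  0, 0, 0]]
     else if \<alpha> = 2 then vector [
       vector [  0,  0,  0, -\<i>],
       vector [  0,  0, \<i>,   0],
       vector [  0, \<i>,  0,   0],
       vector [-\<i>,  0,  0,   0]]
     else vector [
       vector [ 0, 0, 1,  0],
       vector [ 0, 0, 0, -1],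
       vector [-1, 0, 0,  0],
       vector [ 0, 1, 0,  0]])"

definition chi :: "4 \<Rightarrow> complex ^ 2"
  where "chi s = (if s = 1 then vector [1, 0] else vector [0, 1])"

text \<open>The spinors \<open>u_spinor\<close> are used for \<open>s = 1, 2\<close> only, the \<open>v_spinor\<close> for \<open>s = 3, 4\<close> only.\<close>

definition u_spinor :: "real \<Rightarrow> real \<Rightarrow> 4 \<Rightarrow> real ^ 3 \<Rightarrow> complex ^ 4"
  where "u_spinor c \<kappa> s k =
    (let w = omega c \<kappa> k;
         up = complex_of_real (w + c * \<kappa>) *s chi s;
         lo = complex_of_real c *s ((\<Sum>\<alpha>\<in>UNIV. complex_of_real (k $ \<alpha>) *\<^sub>M pauli \<alpha>) *v chi s)
     in complex_of_real (1 / sqrt (w * (w + c * \<kappa>))) *s vector [up $ 1, up $ 2, lo $ 1, lo $ 2])"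

definition v_spinor :: "real \<Rightarrow> real \<Rightarrow> 4 \<Rightarrow> real ^ 3 \<Rightarrow> complex ^ 4"
  where "v_spinor c \<kappa> s k = (\<i> *\<^sub>M gamma 2) *v vec_cnj (u_spinor c \<kappa> (s - 2) k)"

definition psi_field :: "real \<Rightarrow> real \<Rightarrow> 4 \<Rightarrow> real ^ 3 \<Rightarrow> real ^ 3 \<Rightarrow> fermi_op"
  where "psi_field c \<kappa> r k x =
    (\<Sum>s\<in>{1, 2}. u_spinor c \<kappa> s k $ r *\<^sub>M cis (k \<bullet> x) *\<^sub>M phi s) +
    (\<Sum>s\<in>{3, 4}. v_spinor c \<kappa> s k $ r *\<^sub>M cis (- (k \<bullet> x)) *\<^sub>M phi_dag s)"

definition dirac_adjoint :: "(4 \<Rightarrow> fermi_op) \<Rightarrow> 4 \<Rightarrow> fermi_op"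
  where "dirac_adjoint F r = (\<Sum>r'\<in>UNIV. gamma0 $ r' $ r *\<^sub>M dagger (F r'))"

text \<open>
  The matrix \<open>G\<close> is one of the Dirac matrices.  As the scalar potential vanishes, only the
  spatial components \<open>G = gamma \<alpha>\<close> enter the interaction.
\<close>

definition J_field ::
  "real \<Rightarrow> real \<Rightarrow> complex ^ 4 ^ 4 \<Rightarrow> real ^ 3 \<Rightarrow> real ^ 3 \<Rightarrow> real ^ 3 \<Rightarrow> fermi_op"
  where "J_field c \<kappa> G k k' x =
    (1 / 2) *\<^sub>M (\<Sum>r\<in>UNIV. \<Sum>r'\<in>UNIV. G $ r $ r' *\<^sub>M
      (dirac_adjoint (\<lambda>r. psi_field c \<kappa> r k x) r ** psi_field c \<kappa> r' k' x)) -
    (1 / 2) *\<^sub>M (\<Sum>r\<in>UNIV. \<Sum>r'\<in>UNIV. G $ r' $ r *\<^sub>M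
      (psi_field c \<kappa> r k x ** dirac_adjoint (\<lambda>r. psi_field c \<kappa> r k' x) r'))"

text \<open>
  For \<open>\<zeta>\<close>, \<open>\<eta>\<close>, \<open>\<theta>\<close> in \<open>{1, -1}\<close>, \<open>A_part \<zeta>\<close> is the coefficient of
  \<open>cis (\<zeta> * (kph \<bullet> x))\<close> in \<open>A_field\<close>, \<open>psi_part \<eta>\<close> that of \<open>cis (\<eta> * (k \<bullet> x))\<close> in
  \<open>psi_field\<close>, and \<open>J_part \<eta> \<theta>\<close> that of \<open>cis ((\<eta> *\<^sub>R k + \<theta> *\<^sub>R k') \<bullet> x)\<close> in \<open>J_field\<close>.
  Taking the adjoint reverses the sign of the phase.  The decomposition of the integrand of the
  interaction Hamiltonian is \<open>interaction_plane_waves\<close>.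
\<close>

definition A_part ::
  "real \<Rightarrow> (real ^ 3 \<Rightarrow> real ^ 3) \<Rightarrow> (real ^ 3 \<Rightarrow> real ^ 3) \<Rightarrow> real \<Rightarrow> 3 \<Rightarrow> real ^ 3 \<Rightarrow> fock \<Rightarrow> fock"
  where "A_part lam \<epsilon>H \<epsilon>V \<zeta> \<alpha> kph \<Psi> = (\<lambda>p.
    complex_of_real (lam / 2 * \<epsilon>H kph $ \<alpha>) *s (if \<zeta> = 1 then a_H \<Psi> p else a_H_dag \<Psi> p) +
    complex_of_real (lam / 2 * \<epsilon>V kph $ \<alpha>) *s (if \<zeta> = 1 then a_V \<Psi> p else a_V_dag \<Psi> p))"

definition psi_part :: "real \<Rightarrow> real \<Rightarrow> real \<Rightarrow> real ^ 3 \<Rightarrow> 4 \<Rightarrow> fermi_op"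
  where "psi_part c \<kappa> \<eta> k r =
    (if \<eta> = 1 then \<Sum>s\<in>{1, 2}. u_spinor c \<kappa> s k $ r *\<^sub>M phi s
     else \<Sum>s\<in>{3, 4}. v_spinor c \<kappa> s k $ r *\<^sub>M phi_dag s)"

definition J_part ::
  "real \<Rightarrow> real \<Rightarrow> complex ^ 4 ^ 4 \<Rightarrow> real \<Rightarrow> real \<Rightarrow> real ^ 3 \<Rightarrow> real ^ 3 \<Rightarrow> fermi_op"
  where "J_part c \<kappa> G \<eta> \<theta> k k' =
    (1 / 2) *\<^sub>M (\<Sum>r\<in>UNIV. \<Sum>r'\<in>UNIV. G $ r $ r' *\<^sub>M
      (dirac_adjoint (psi_part c \<kappa> (- \<eta>) k) r ** psi_part c \<kappa> \<theta> k' r')) -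
    (1 / 2) *\<^sub>M (\<Sum>r\<in>UNIV. \<Sum>r'\<in>UNIV. G $ r' $ r *\<^sub>M
      (psi_part c \<kappa> \<eta> k r ** dirac_adjoint (psi_part c \<kappa> (- \<theta>) k') r'))"

lemma cscale_nth [simp]: "(a *\<^sub>M M) $ i $ j = a * M $ i $ j"
  by (simp add: cscale_def)

lemma cscale_simps:
  "a *\<^sub>M (M + N) = a *\<^sub>M M + a *\<^sub>M N" "a *\<^sub>M (M - N) = a *\<^sub>M M - a *\<^sub>M N"
  "a *\<^sub>M b *\<^sub>M M = (a * b) *\<^sub>M M"
  "a *\<^sub>M (\<Sum>i\<in>I. F i) = (\<Sum>i\<in>I. a *\<^sub>M F i)"
  by (simp_all add: vec_eq_iff cscale_def algebra_simps sum_distrib_left)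

lemma dagger_simps:
  "dagger (M + N) = dagger M + dagger N" "dagger (a *\<^sub>M M) = cnj a *\<^sub>M dagger M"
  by (simp_all add: vec_eq_iff dagger_def)

lemma cscale_mult:
  "(a *\<^sub>M M) ** N = a *\<^sub>M (M ** N)" "M ** (a *\<^sub>M N) = a *\<^sub>M (M ** N)"
  by (simp_all add: vec_eq_iff matrix_matrix_mult_def sum_distrib_left ac_simps)

lemma matrix_distrib:
  fixes A B C :: fermi_op
  shows "(A + B) ** C = A ** C + B ** C" "C ** (A + B) = C ** A + C ** B"
  by (simp_all add: vec_eq_iff matrix_matrix_mult_def sum.distrib algebra_simps)

lemma psi_field_parts:
  "psi_field c \<kappa> r k x =
    cis (k \<bullet> x) *\<^sub>M psi_part c \<kappa> 1 k r + cis (- (k \<bullet> x)) *\<^sub>M psi_part c \<kappa> (- 1) k r"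
  by (simp add: psi_field_def psi_part_def cscale_simps mult.commute)

lemma dirac_adjoint_parts:
  "dirac_adjoint (\<lambda>r. psi_field c \<kappa> r k x) r =
    cis (k \<bullet> x) *\<^sub>M dirac_adjoint (psi_part c \<kappa> (- 1) k) r +
    cis (- (k \<bullet> x)) *\<^sub>M dirac_adjoint (psi_part c \<kappa> 1 k) r"
  by (simp add: dirac_adjoint_def psi_field_parts dagger_simps cscale_simps cis_cnj
        sum.distrib mult.commute add.commute)

lemma J_field_parts:
  "J_field c \<kappa> G k k' x = (\<Sum>\<eta>\<in>{1, -1}. \<Sum>\<theta>\<in>{1, -1}.
      cis ((\<eta> *\<^sub>R k + \<theta> *\<^sub>R k') \<bullet> x) *\<^sub>M J_part c \<kappa> G \<eta> \<theta> k k')"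
proof -
  define K where "K H B C = (1 / 2) *\<^sub>M (\<Sum>r\<in>UNIV. \<Sum>r'\<in>UNIV. H r r' *\<^sub>M (B r ** C r'))"
    for H :: "4 \<Rightarrow> 4 \<Rightarrow> complex" and B C :: "4 \<Rightarrow> fermi_op"
  have K_add: "K H (\<lambda>r. B r + B' r) C = K H B C + K H B' C"
    "K H B (\<lambda>r. C r + C' r) = K H B C + K H B C'" for H B B' C C'
    by (simp_all only: K_def matrix_distrib cscale_simps sum.distrib)
  have K_scale: "K H (\<lambda>r. a *\<^sub>M B r) C = a *\<^sub>M K H B C"
    "K H B (\<lambda>r. a *\<^sub>M C r) = a *\<^sub>M K H B C" for H a B C
    by (simp_all add: K_def cscale_mult cscale_simps mult.left_commute mult.commute)
  have J: "J_field c \<kappa> G k k' x =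
      K (\<lambda>r r'. G $ r $ r') (\<lambda>r. dirac_adjoint (\<lambda>r. psi_field c \<kappa> r k x) r)
        (\<lambda>r. psi_field c \<kappa> r k' x) -
      K (\<lambda>r r'. G $ r' $ r) (\<lambda>r. psi_field c \<kappa> r k x)
        (\<lambda>r. dirac_adjoint (\<lambda>r. psi_field c \<kappa> r k' x) r)"
    by (simp only: J_field_def K_def)
  have J': "J_part c \<kappa> G \<eta> \<theta> k k' =
      K (\<lambda>r r'. G $ r $ r') (\<lambda>r. dirac_adjoint (psi_part c \<kappa> (- \<eta>) k) r)
        (\<lambda>r. psi_part c \<kappa> \<theta> k' r) -
      K (\<lambda>r r'. G $ r' $ r) (\<lambda>r. psi_part c \<kappa> \<eta> k r)
        (\<lambda>r. dirac_adjoint (psi_part c \<kappa> (- \<theta>) k') r)" for \<eta> \<theta>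
    by (simp only: J_part_def K_def)
  define e f where "e = cis (k \<bullet> x)" and "f = cis (k' \<bullet> x)"
  define e' f' where "e' = cis (- (k \<bullet> x))" and "f' = cis (- (k' \<bullet> x))"
  have c: "cis ((k + k') \<bullet> x) = e * f" "cis ((k - k') \<bullet> x) = e * f'"
    "cis ((- k + k') \<bullet> x) = e' * f" "cis ((- k - k') \<bullet> x) = e' * f'"
    by (simp_all add: e_def f_def e'_def f'_def cis_mult inner_add_left inner_diff_left)
  have two: "(\<Sum>i\<in>{1, -1}. F i) = F 1 + F (-1)" for F :: "real \<Rightarrow> fermi_op"
    by simp
  have s1: "1 *\<^sub>R k + 1 *\<^sub>R k' = k + k'" "1 *\<^sub>R k + (-1) *\<^sub>R k' = k - k'"
    "(-1) *\<^sub>R k + 1 *\<^sub>R k' = - k + k'" "(-1) *\<^sub>R k + (-1) *\<^sub>R k' = - k - k'"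
    by simp_all
  show ?thesis
    unfolding J dirac_adjoint_parts two s1 c
    unfolding psi_field_parts e_def[symmetric] f_def[symmetric] e'_def[symmetric] f'_def[symmetric]
      J' K_add K_scale minus_minus
    by (simp only: cscale_simps) (simp add: mult.commute)
qed

lemma A_field_parts:
  "A_field lam \<epsilon>H \<epsilon>V \<alpha> kph x \<Psi> p =
    (\<Sum>\<zeta>\<in>{1, -1}. cis (\<zeta> *\<^sub>R kph \<bullet> x) *s A_part lam \<epsilon>H \<epsilon>V \<zeta> \<alpha> kph \<Psi> p)"
  by (simp add: A_field_def A_part_def vec_eq_iff distrib_left ac_simps)

lemma interaction_plane_waves:
  "(\<Sum>\<alpha>\<in>UNIV. A_field lam \<epsilon>H \<epsilon>V \<alpha> kph x (\<lambda>p. J_field c \<kappa> (gamma \<alpha>) k k' x *v \<Psi> p) p) =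
   (\<Sum>\<zeta>\<in>{1, -1}. \<Sum>\<eta>\<in>{1, -1}. \<Sum>\<theta>\<in>{1, -1}.
      cis ((\<zeta> *\<^sub>R kph + \<eta> *\<^sub>R k + \<theta> *\<^sub>R k') \<bullet> x) *s
      (\<Sum>\<alpha>\<in>UNIV. A_part lam \<epsilon>H \<epsilon>V \<zeta> \<alpha> kph
        (\<lambda>p. J_part c \<kappa> (gamma \<alpha>) \<eta> \<theta> k k' *v \<Psi> p) p))"
proof -
  have a_add: "O' (\<lambda>p. F p + G p) p = O' F p + O' G p"
    and a_scale: "O' (\<lambda>p. a *s F p) p = a *s O' F p"
    if "O' \<in> {a_H, a_V, a_H_dag, a_V_dag}" for O' F G a p
    using that by (auto simp: a_H_def a_V_def a_H_dag_def a_V_dag_def scaleR_add_right vec_eq_iff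
        split: prod.split)
  have lin: "A_part lam \<epsilon>H \<epsilon>V \<zeta> \<alpha> kph (\<lambda>p. F p + G p) p =
      A_part lam \<epsilon>H \<epsilon>V \<zeta> \<alpha> kph F p + A_part lam \<epsilon>H \<epsilon>V \<zeta> \<alpha> kph G p"
    "A_part lam \<epsilon>H \<epsilon>V \<zeta> \<alpha> kph (\<lambda>p. a *s F p) p = a *s A_part lam \<epsilon>H \<epsilon>V \<zeta> \<alpha> kph F p"
    for \<zeta> \<alpha> F G a p
    by (simp_all add: A_part_def a_add a_scale vec.scale_right_distrib ac_simps)
  have mv: "(a *\<^sub>M M) *v v = a *s (M *v v)" for a and M :: fermi_op and v
    by (simp add: vec_eq_iff matrix_vector_mult_def sum_distrib_left mult.assoc)
  have lin2: "A_part lam \<epsilon>H \<epsilon>V \<zeta> \<alpha> kph (\<lambda>p. \<Sum>\<eta>\<in>{1, -1}. \<Sum>\<theta>\<in>{1, -1}. a \<eta> \<theta> *s F \<eta> \<theta> p) p =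
      (\<Sum>\<eta>\<in>{1, -1}. \<Sum>\<theta>\<in>{1, -1}. a \<eta> \<theta> *s A_part lam \<epsilon>H \<epsilon>V \<zeta> \<alpha> kph (F \<eta> \<theta>) p)"
    for \<zeta> \<alpha> p and a :: "real \<Rightarrow> real \<Rightarrow> complex" and F
    by (simp add: lin)
  have Jv: "J_field c \<kappa> G k k' x *v v = (\<Sum>\<eta>\<in>{1, -1}. \<Sum>\<theta>\<in>{1, -1}.
      cis ((\<eta> *\<^sub>R k + \<theta> *\<^sub>R k') \<bullet> x) *s (J_part c \<kappa> G \<eta> \<theta> k k' *v v))" for G v
    unfolding J_field_parts by (simp add: matrix_vector_mult_add_rdistrib mv)
  have A: "A_field lam \<epsilon>H \<epsilon>V \<alpha> kph x (\<lambda>p. J_field c \<kappa> (gamma \<alpha>) k k' x *v \<Psi> p) p =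
      (\<Sum>\<zeta>\<in>{1, -1}. \<Sum>\<eta>\<in>{1, -1}. \<Sum>\<theta>\<in>{1, -1}.
        cis ((\<zeta> *\<^sub>R kph + \<eta> *\<^sub>R k + \<theta> *\<^sub>R k') \<bullet> x) *s
        A_part lam \<epsilon>H \<epsilon>V \<zeta> \<alpha> kph (\<lambda>p. J_part c \<kappa> (gamma \<alpha>) \<eta> \<theta> k k' *v \<Psi> p) p)" for \<alpha>
    unfolding A_field_parts Jv lin2 vec.scale_sum_right vector_smult_assoc cis_mult
    by (simp only: inner_add_left add.assoc)
  have swap: "(\<Sum>\<alpha>\<in>(UNIV :: 3 set). \<Sum>\<zeta>\<in>{1, -1}. \<Sum>\<eta>\<in>{1, -1}. \<Sum>\<theta>\<in>{1, -1}. a \<zeta> \<eta> \<theta> *s F \<alpha> \<zeta> \<eta> \<theta>) =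
      (\<Sum>\<zeta>\<in>{1, -1}. \<Sum>\<eta>\<in>{1, -1}. \<Sum>\<theta>\<in>{1, -1}. a \<zeta> \<eta> \<theta> *s (\<Sum>\<alpha>\<in>UNIV. F \<alpha> \<zeta> \<eta> \<theta>))"
    for a :: "real \<Rightarrow> real \<Rightarrow> real \<Rightarrow> complex" and F :: "3 \<Rightarrow> real \<Rightarrow> real \<Rightarrow> real \<Rightarrow> fermi"
    by (simp add: sum.distrib vec.scale_sum_right)
  show ?thesis
    unfolding A by (rule swap)
qed

lemma phase_zero_iff:
  fixes kph k k' :: "real ^ 3"
  assumes "\<theta> \<in> {1, -1}"
  shows "\<zeta> *\<^sub>R kph + \<eta> *\<^sub>R k + \<theta> *\<^sub>R k' = 0 \<longleftrightarrow> k' = - \<theta> *\<^sub>R (\<zeta> *\<^sub>R kph + \<eta> *\<^sub>R k)"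
proof -
  have "\<theta> *\<^sub>R k' = - a \<longleftrightarrow> k' = - \<theta> *\<^sub>R a" for a :: "real ^ 3"
    using assms by auto
  then show ?thesis by (simp only: add.commute[of _ "\<theta> *\<^sub>R k'"] eq_neg_iff_add_eq_0)
qed

text \<open>
  In each plane-wave component, integrating over \<open>x\<close> gives the factor
  \<open>(2 * pi) ^ 3\<close> times the Dirac delta of \<open>\<zeta> *\<^sub>R kph + \<eta> *\<^sub>R k + \<theta> *\<^sub>R k'\<close>,
  and integrating over \<open>k'\<close> then evaluates the component at the only zero of the phase.
\<close>

definition H_I ::
  "real \<Rightarrow> real \<Rightarrow> real \<Rightarrow> real \<Rightarrow> (real ^ 3 \<Rightarrow> real ^ 3) \<Rightarrow> (real ^ 3 \<Rightarrow> real ^ 3) \<Rightarrow> wave \<Rightarrow> wave"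
  where "H_I q c \<kappa> lam \<epsilon>H \<epsilon>V \<psi> kph k = (\<lambda>p.
    (q * c) *\<^sub>R (\<Sum>\<zeta>\<in>{1, -1}. \<Sum>\<eta>\<in>{1, -1}. \<Sum>\<theta>\<in>{1, -1}.
      let k' = - \<theta> *\<^sub>R (\<zeta> *\<^sub>R kph + \<eta> *\<^sub>R k)
      in \<Sum>\<alpha>\<in>UNIV. A_part lam \<epsilon>H \<epsilon>V \<zeta> \<alpha> kph
        (\<lambda>p'. J_part c \<kappa> (gamma \<alpha>) \<eta> \<theta> k k' *v \<psi> kph k' p') p))"

end

theory Submission
  imports Defs
begin

text \<open>
  The current creates an electron-positron pair out of the vacuum, and the vector potential a photon,
  so a state that is mostly vacuum with a small amplitude \<open>b\<close> of one photon and one pair has an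
  interaction energy linear in \<open>b\<close>, while its photon energy and its electron density are quadratic
  in \<open>b\<close>.  For small \<open>b\<close> the interaction wins, and \<open>b\<close> is dictated by the prescribed density.

  The wave vectors of photon, electron and positron satisfy \<open>k' = - kph - k\<close>.  For \<open>kph\<close> in a small
  ball \<open>P\<close> off the third axis and \<open>k\<close> in a small ball \<open>K\<close> around the origin, the pair current is a
  real vector close to a nonzero multiple of the third axis.  Taking the polarization of the photon along the part of the third axis
  transverse to \<open>kph\<close> makes the interaction energy independent of the choice of polarization
  vectors and pointwise of one sign.  For \<open>k\<close> outside \<open>K\<close> the prescribed density is carried by the
  photonless pair in the modes \<open>2, 3\<close>, which the interaction does not connect to any other
  component of the state:
  the vector potential changes the photon number, and the current changes at most two of the four
  occupation numbers in which it differs from the pair in the modes \<open>1, 4\<close>.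
\<close>

subsection \<open>Matrix elements of the current\<close>

text \<open>The numeral \<open>4\<close> denotes the residue \<open>0\<close> of its type, hence the
  least mode. This order decides the Jordan-Wigner signs of the pair in modes
  \<open>1, 4\<close>.\<close>

lemma four_less_one: "(4::4) < 1"
  by (simp add: less_bit0_def bit0.Rep_numeral bit0.Rep_1)

lemma jw_sign_simps:
  "jw_sign s {} = 1"
  "jw_sign s {t} = (if t < s then - 1 else 1)"
  "t \<noteq> u \<Longrightarrow> jw_sign s {t, u} = (if t < s then - 1 else 1) * (if u < s then - 1 else 1)"
  by (simp_all add: jw_sign_insert) (simp_all add: jw_sign_def)

text \<open>A set containing both \<open>1\<close> and \<open>4\<close> is never a singleton. This
  excludes \<open>phi s ** phi_dag t\<close> between the vacuum and the pair, which preserves or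
  shifts particle number the wrong way.\<close>

lemma singleton_neq_insert_pair: "insert s {1, 4::4} \<noteq> {t}" "{t} \<noteq> insert s {1, 4::4}"
proof -
  have "(1::4) \<noteq> 4" by simp
  then show "insert s {1, 4::4} \<noteq> {t}" "{t} \<noteq> insert s {1, 4::4}" by blast+
qed

text \<open>Reaching \<open>{1, 4}\<close> from the vacuum takes the creators of exactly these two
  modes, in either order. As \<open>4\<close> precedes \<open>1\<close>, the sign is negative when
  the creator of mode \<open>1\<close> acts last.\<close>

lemma create_pair_nth:
  "(phi_dag s ** phi_dag t) $ {1, 4} $ {} =
    (if s = 1 \<and> t = 4 then - 1 else if s = 4 \<and> t = 1 then 1 else 0)"
  "(phi s ** phi t) $ {1, 4} $ {} = 0"
  "(phi s ** phi_dag t) $ {1, 4} $ {} = 0"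
  "(phi_dag s ** phi t) $ {1, 4} $ {} = 0"
proof -
  have d: "{1, 4} - {4} = {1::4}" "{1, 4} - {1} = {4::4}" by auto
  have j: "jw_sign 1 {1, 4} = - 1" "jw_sign 4 {1, 4} = 1"
    using four_less_one less_asym[OF four_less_one] by (simp_all add: jw_sign_simps)
  have t: "{u} = {t} \<longleftrightarrow> t = u" for u by blast
  consider "s = 1" | "s = 4" | "s \<notin> {1, 4}" by blast
  then show "(phi_dag s ** phi_dag t) $ {1, 4} $ {} =
      (if s = 1 \<and> t = 4 then - 1 else if s = 4 \<and> t = 1 then 1 else 0)"
    by cases (simp_all add: phi_dag_mult_nth phi_dag_nth d j t jw_sign_simps(1))
qed (simp_all add: phi_mult_nth phi_dag_mult_nth phi_nth phi_dag_nth singleton_neq_insert_pair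
    del: singleton_insert_inj_eq singleton_insert_inj_eq')

lemma annihilate_pair_nth:
  "(phi s ** phi t) $ {} $ {1, 4} =
    (if s = 1 \<and> t = 4 then 1 else if s = 4 \<and> t = 1 then - 1 else 0)"
  "(phi_dag s ** phi_dag t) $ {} $ {1, 4} = 0"
  "(phi s ** phi_dag t) $ {} $ {1, 4} = 0"
  "(phi_dag s ** phi t) $ {} $ {1, 4} = 0"
proof -
  have *: "t \<notin> {s} \<and> {1, 4} = insert t {s} \<longleftrightarrow> s = 1 \<and> t = 4 \<or> s = 4 \<and> t = 1"
    by (simp only: doubleton_eq_iff) force
  have j: "jw_sign 4 {1} = 1" "jw_sign 1 {4} = - 1"
    using four_less_one less_asym[OF four_less_one] by (simp_all add: jw_sign_simps)
  show "(phi s ** phi t) $ {} $ {1, 4} =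
      (if s = 1 \<and> t = 4 then 1 else if s = 4 \<and> t = 1 then - 1 else 0)"
    unfolding phi_mult_nth phi_nth * by (simp add: jw_sign_simps(1) j)
qed (simp_all add: phi_mult_nth phi_dag_mult_nth phi_nth phi_dag_nth singleton_neq_insert_pair
    del: singleton_insert_inj_eq singleton_insert_inj_eq')

text \<open>A product of two mode operators changes at most two occupation numbers, while
  \<open>S\<close> and \<open>T\<close> differ at least in \<open>a\<close>, \<open>b\<close> and
  \<open>d\<close>. This decouples the pair \<open>{2, 3}\<close> from
  \<open>{1, 4}\<close>.\<close>

lemma transfer_pair_nth:
  assumes "a \<in> S - T" "b \<in> S - T" "a \<noteq> b" "d \<in> T - S"
  shows "(phi s ** phi t) $ S $ T = 0" "(phi_dag s ** phi_dag t) $ S $ T = 0"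
    "(phi s ** phi_dag t) $ S $ T = 0" "(phi_dag s ** phi t) $ S $ T = 0"
proof -
  have "T \<noteq> insert t (insert s S)" "S - {s} \<noteq> insert t T"
    using assms by blast+
  moreover have "\<exists>x\<in>S - T. x \<noteq> u" for u
    using assms by (cases "u = a") auto
  then have "insert s S \<noteq> insert t T" "T \<noteq> insert t (S - {s})"
    by blast+
  ultimately show "(phi s ** phi t) $ S $ T = 0" "(phi_dag s ** phi_dag t) $ S $ T = 0"
    "(phi s ** phi_dag t) $ S $ T = 0" "(phi_dag s ** phi t) $ S $ T = 0"
    by (simp_all add: phi_mult_nth phi_dag_mult_nth phi_nth phi_dag_nth)
qed

lemma matrix_mult_sum_nth:
  fixes X Y :: "'s \<Rightarrow> fermi_op"
  shows "((\<Sum>s\<in>I. a s *\<^sub>M X s) ** (\<Sum>t\<in>J. b t *\<^sub>M Y t)) $ S $ T =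
    (\<Sum>s\<in>I. \<Sum>t\<in>J. a s * b t * (X s ** Y t) $ S $ T)"
proof -
  have "((\<Sum>s\<in>I. a s *\<^sub>M X s) ** (\<Sum>t\<in>J. b t *\<^sub>M Y t)) $ S $ T =
      (\<Sum>U\<in>UNIV. \<Sum>s\<in>I. \<Sum>t\<in>J. a s * X s $ S $ U * (b t * Y t $ U $ T))"
    by (simp add: matrix_matrix_mult_def sum_product)
  also have "\<dots> = (\<Sum>s\<in>I. \<Sum>t\<in>J. \<Sum>U\<in>UNIV. a s * X s $ S $ U * (b t * Y t $ U $ T))"
    by (rule trans[OF sum.swap sum.cong[OF refl sum.swap]])
  finally show ?thesis
    by (simp add: matrix_matrix_mult_def sum_distrib_left ac_simps)
qed

lemma dagger_sum: "dagger (\<Sum>s\<in>I. M s) = (\<Sum>s\<in>I. dagger (M s))"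
  by (simp add: vec_eq_iff dagger_def)

lemma dagger_dagger: "dagger (dagger M) = M"
  by (simp add: vec_eq_iff dagger_def)

lemma gamma0_nth: "r \<noteq> r' \<Longrightarrow> gamma0 $ r $ r' = 0"
  using exhaust_4[of r] exhaust_4[of r'] by (auto simp: gamma0_def)

text \<open>Since \<open>gamma0\<close> is diagonal, the sum defining the Dirac adjoint collapses to
  one term.\<close>

lemma dirac_adjoint_psi_part:
  "dirac_adjoint (psi_part c \<kappa> 1 k) r =
    (\<Sum>s\<in>{1, 2}. (gamma0 $ r $ r * cnj (u_spinor c \<kappa> s k $ r)) *\<^sub>M phi_dag s)"
  "dirac_adjoint (psi_part c \<kappa> (- 1) k) r =
    (\<Sum>s\<in>{3, 4}. (gamma0 $ r $ r * cnj (v_spinor c \<kappa> s k $ r)) *\<^sub>M phi s)"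
proof -
  have "dirac_adjoint F r = gamma0 $ r $ r *\<^sub>M dagger (F r)" for F
  proof -
    have "gamma0 $ r' $ r *\<^sub>M dagger (F r') = (if r' = r then gamma0 $ r $ r *\<^sub>M dagger (F r) else 0)"
      for r' by (cases "r' = r") (simp_all add: gamma0_nth vec_eq_iff)
    then have "dirac_adjoint F r = (\<Sum>r'\<in>UNIV. if r' = r then gamma0 $ r $ r *\<^sub>M dagger (F r) else 0)"
      unfolding dirac_adjoint_def by (rule sum.cong[OF refl])
    also have "\<dots> = gamma0 $ r $ r *\<^sub>M dagger (F r)"
      by simp
    finally show ?thesis .
  qed
  then show "dirac_adjoint (psi_part c \<kappa> 1 k) r =
    (\<Sum>s\<in>{1, 2}. (gamma0 $ r $ r * cnj (u_spinor c \<kappa> s k $ r)) *\<^sub>M phi_dag s)"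
  "dirac_adjoint (psi_part c \<kappa> (- 1) k) r =
    (\<Sum>s\<in>{3, 4}. (gamma0 $ r $ r * cnj (v_spinor c \<kappa> s k $ r)) *\<^sub>M phi s)"
    by (simp_all add: psi_part_def dagger_sum dagger_simps cscale_simps phi_dag_def dagger_dagger)
qed

lemma psi_part_sum:
  "psi_part c \<kappa> 1 k r = (\<Sum>s\<in>{1, 2}. u_spinor c \<kappa> s k $ r *\<^sub>M phi s)"
  "psi_part c \<kappa> (- 1) k r = (\<Sum>s\<in>{3, 4}. v_spinor c \<kappa> s k $ r *\<^sub>M phi_dag s)"
  by (simp_all only: psi_part_def) simp_all

text \<open>In both orderings of the current, a sign \<open>+1\<close> belongs to an annihilator and
  a sign \<open>-1\<close> to a creator. So \<open>J_part\<close> contains only one kind of product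
  for given signs, and its matrix element vanishes if that product's does.\<close>

lemma J_part_nth_eq_0:
  assumes "\<And>s t. (\<eta>, \<theta>) = (1, 1) \<Longrightarrow> (phi s ** phi t) $ S $ T = 0"
    "\<And>s t. (\<eta>, \<theta>) = (- 1, - 1) \<Longrightarrow> (phi_dag s ** phi_dag t) $ S $ T = 0"
    "\<And>s t. (phi s ** phi_dag t) $ S $ T = 0"  "\<And>s t. (phi_dag s ** phi t) $ S $ T = 0"
    and "\<eta> \<in> {1, - 1}" "\<theta> \<in> {1, - 1}"
  shows "J_part c \<kappa> G \<eta> \<theta> k k' $ S $ T = 0"
proof -
  consider "\<eta> = 1" "\<theta> = 1" | "\<eta> = 1" "\<theta> = - 1" | "\<eta> = - 1" "\<theta> = 1" | "\<eta> = - 1" "\<theta> = - 1"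
    using assms(5,6) by blast
  then show ?thesis
    by cases (simp_all only: J_part_def minus_minus dirac_adjoint_psi_part psi_part_sum
        vector_minus_component cscale_nth sum_component matrix_mult_sum_nth assms(1-4)
        mult_zero_right sum.neutral_const diff_zero)
qed

lemma J_part_create_pair:
  "J_part c \<kappa> G (- 1) (- 1) k k' $ {1, 4} $ {} =
    - (1 / 2) * (\<Sum>r\<in>UNIV. \<Sum>r'\<in>UNIV. G $ r $ r' * gamma0 $ r $ r *
      (cnj (u_spinor c \<kappa> 1 k $ r) * v_spinor c \<kappa> 4 k' $ r' +
       cnj (u_spinor c \<kappa> 1 k' $ r) * v_spinor c \<kappa> 4 k $ r'))"
proof -
  have 1: "(dirac_adjoint (psi_part c \<kappa> 1 k) r ** psi_part c \<kappa> (- 1) k' r') $ {1, 4} $ {} =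
      - (gamma0 $ r $ r * cnj (u_spinor c \<kappa> 1 k $ r) * v_spinor c \<kappa> 4 k' $ r')" for k k' r r'
    unfolding dirac_adjoint_psi_part psi_part_sum matrix_mult_sum_nth create_pair_nth by simp
  have 2: "(psi_part c \<kappa> (- 1) k r ** dirac_adjoint (psi_part c \<kappa> 1 k') r') $ {1, 4} $ {} =
      gamma0 $ r' $ r' * cnj (u_spinor c \<kappa> 1 k' $ r') * v_spinor c \<kappa> 4 k $ r" for k k' r r'
    unfolding dirac_adjoint_psi_part psi_part_sum matrix_mult_sum_nth create_pair_nth by simp
  have "J_part c \<kappa> G (- 1) (- 1) k k' $ {1, 4} $ {} =
    1 / 2 * (\<Sum>r\<in>UNIV. \<Sum>r'\<in>UNIV. G $ r $ r' *
      - (gamma0 $ r $ r * cnj (u_spinor c \<kappa> 1 k $ r) * v_spinor c \<kappa> 4 k' $ r')) -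
    1 / 2 * (\<Sum>r'\<in>UNIV. \<Sum>r\<in>UNIV. G $ r $ r' *
      (gamma0 $ r $ r * cnj (u_spinor c \<kappa> 1 k' $ r) * v_spinor c \<kappa> 4 k $ r'))"
    by (simp only: J_part_def minus_minus vector_minus_component cscale_nth sum_component 1 2)
  also have "(\<Sum>r'\<in>UNIV. \<Sum>r\<in>UNIV. G $ r $ r' *
      (gamma0 $ r $ r * cnj (u_spinor c \<kappa> 1 k' $ r) * v_spinor c \<kappa> 4 k $ r')) =
      (\<Sum>r\<in>UNIV. \<Sum>r'\<in>UNIV. G $ r $ r' *
      (gamma0 $ r $ r * cnj (u_spinor c \<kappa> 1 k' $ r) * v_spinor c \<kappa> 4 k $ r'))"
    by (rule sum.swap)
  finally show ?thesis
    by (simp add: distrib_left sum.distrib sum_negf mult.assoc)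
qed

lemma J_part_annihilate_pair:
  "J_part c \<kappa> G 1 1 k k' $ {} $ {1, 4} =
    - (1 / 2) * (\<Sum>r\<in>UNIV. \<Sum>r'\<in>UNIV. G $ r $ r' * gamma0 $ r $ r *
      (cnj (v_spinor c \<kappa> 4 k $ r) * u_spinor c \<kappa> 1 k' $ r' +
       cnj (v_spinor c \<kappa> 4 k' $ r) * u_spinor c \<kappa> 1 k $ r'))"
proof -
  have 1: "(dirac_adjoint (psi_part c \<kappa> (- 1) k) r ** psi_part c \<kappa> 1 k' r') $ {} $ {1, 4} =
      - (gamma0 $ r $ r * cnj (v_spinor c \<kappa> 4 k $ r) * u_spinor c \<kappa> 1 k' $ r')" for k k' r r'
    unfolding dirac_adjoint_psi_part psi_part_sum matrix_mult_sum_nth annihilate_pair_nth by simp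
  have 2: "(psi_part c \<kappa> 1 k r ** dirac_adjoint (psi_part c \<kappa> (- 1) k') r') $ {} $ {1, 4} =
      gamma0 $ r' $ r' * cnj (v_spinor c \<kappa> 4 k' $ r') * u_spinor c \<kappa> 1 k $ r" for k k' r r'
    unfolding dirac_adjoint_psi_part psi_part_sum matrix_mult_sum_nth annihilate_pair_nth by simp
  have "J_part c \<kappa> G 1 1 k k' $ {} $ {1, 4} =
    1 / 2 * (\<Sum>r\<in>UNIV. \<Sum>r'\<in>UNIV. G $ r $ r' *
      - (gamma0 $ r $ r * cnj (v_spinor c \<kappa> 4 k $ r) * u_spinor c \<kappa> 1 k' $ r')) -
    1 / 2 * (\<Sum>r'\<in>UNIV. \<Sum>r\<in>UNIV. G $ r $ r' *
      (gamma0 $ r $ r * cnj (v_spinor c \<kappa> 4 k' $ r) * u_spinor c \<kappa> 1 k $ r'))"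
    by (simp only: J_part_def vector_minus_component cscale_nth sum_component 1 2)
  also have "(\<Sum>r'\<in>UNIV. \<Sum>r\<in>UNIV. G $ r $ r' *
      (gamma0 $ r $ r * cnj (v_spinor c \<kappa> 4 k' $ r) * u_spinor c \<kappa> 1 k $ r')) =
      (\<Sum>r\<in>UNIV. \<Sum>r'\<in>UNIV. G $ r $ r' *
      (gamma0 $ r $ r * cnj (v_spinor c \<kappa> 4 k' $ r) * u_spinor c \<kappa> 1 k $ r'))"
    by (rule sum.swap)
  finally show ?thesis
    by (simp add: distrib_left sum.distrib sum_negf mult.assoc)
qed

subsection \<open>The pair current\<close>

text \<open>The only nonzero upper entry of an electron spinor before scaling;
  \<open>spinor_norm\<close> is the common scalar prefactor.\<close>

definition spinor_up :: "real \<Rightarrow> real \<Rightarrow> real ^ 3 \<Rightarrow> real"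
  where "spinor_up c \<kappa> k = omega c \<kappa> k + c * \<kappa>"

definition spinor_norm :: "real \<Rightarrow> real \<Rightarrow> real ^ 3 \<Rightarrow> real"
  where "spinor_norm c \<kappa> k = 1 / sqrt (omega c \<kappa> k * spinor_up c \<kappa> k)"

lemma u_spinor_nth:
  "u_spinor c \<kappa> 1 k = complex_of_real (spinor_norm c \<kappa> k) *s
    vector [complex_of_real (spinor_up c \<kappa> k), 0, complex_of_real (c * k $ 3), Complex (c * k $ 1) (c * k $ 2)]"
  "u_spinor c \<kappa> 2 k = complex_of_real (spinor_norm c \<kappa> k) *s
    vector [0, complex_of_real (spinor_up c \<kappa> k), Complex (c * k $ 1) (- c * k $ 2), - complex_of_real (c * k $ 3)]"
  by (simp_all add: u_spinor_def Let_def spinor_norm_def spinor_up_def chi_def pauli_def vec_eq_iff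
      forall_4 sum_3 sum_2 matrix_vector_mult_def complex_eq_iff distrib_left)

lemma v_spinor_nth:
  "v_spinor c \<kappa> 4 k = complex_of_real (spinor_norm c \<kappa> k) *s
    vector [- complex_of_real (c * k $ 3), - Complex (c * k $ 1) (c * k $ 2), - complex_of_real (spinor_up c \<kappa> k), 0]"
proof -
  have "(4::4) - 2 = 2" by simp
  then show ?thesis
    by (simp add: v_spinor_def u_spinor_nth vec_eq_iff forall_4 matrix_vector_mult_def sum_4
        gamma_def vec_cnj_def complex_eq_iff)
qed

text \<open>The spatial current between the vacuum and the pair in modes \<open>1, 4\<close>. For
  small wave vectors the product of the upper entries dominates, so the vector is nearly parallel to
  the third axis.\<close>

definition pair_current :: "real \<Rightarrow> real \<Rightarrow> real ^ 3 \<Rightarrow> real ^ 3 \<Rightarrow> real ^ 3"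
  where "pair_current c \<kappa> k k' = (spinor_norm c \<kappa> k * spinor_norm c \<kappa> k') *\<^sub>R
    ((spinor_up c \<kappa> k * spinor_up c \<kappa> k' - c\<^sup>2 * (k \<bullet> k')) *\<^sub>R axis 3 1 +
     c\<^sup>2 *\<^sub>R (k $ 3 *\<^sub>R k' + k' $ 3 *\<^sub>R k))"

text \<open>Follows from the explicit spinors, component by component. The imaginary parts cancel in
  the sum symmetrized over \<open>k\<close> and \<open>k'\<close>, so one real vector serves for
  creation and for annihilation.\<close>

lemma J_part_pair:
  "J_part c \<kappa> (gamma \<alpha>) (- 1) (- 1) k k' $ {1, 4} $ {} = complex_of_real (pair_current c \<kappa> k k' $ \<alpha>)"
  "J_part c \<kappa> (gamma \<alpha>) 1 1 k k' $ {} $ {1, 4} = complex_of_real (pair_current c \<kappa> k k' $ \<alpha>)"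
proof -
  have g: "gamma0 $ r $ r = (if r = 1 \<or> r = 2 then 1 else - 1)" for r
    using exhaust_4[of r] by (auto simp: gamma0_def)
  consider "\<alpha> = 1" | "\<alpha> = 2" | "\<alpha> = 3" using exhaust_3 by blast
  then show "J_part c \<kappa> (gamma \<alpha>) (- 1) (- 1) k k' $ {1, 4} $ {} =
      complex_of_real (pair_current c \<kappa> k k' $ \<alpha>)"
    unfolding J_part_create_pair u_spinor_nth v_spinor_nth pair_current_def
    by cases (simp_all add: sum_4 g gamma_def axis_def inner_vec_def sum_3 complex_eq_iff power2_eq_square, simp_all add: field_simps)
  consider "\<alpha> = 1" | "\<alpha> = 2" | "\<alpha> = 3" using exhaust_3 by blast
  then show "J_part c \<kappa> (gamma \<alpha>) 1 1 k k' $ {} $ {1, 4} = complex_of_real (pair_current c \<kappa> k k' $ \<alpha>)"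
    unfolding J_part_annihilate_pair u_spinor_nth v_spinor_nth pair_current_def
    by cases (simp_all add: sum_4 g gamma_def axis_def inner_vec_def sum_3 complex_eq_iff power2_eq_square, simp_all add: field_simps)
qed

section \<open>Transverse directions in three-dimensional space\<close>

lemma orthonormal_pair_expansion:
  fixes a b p u :: "real ^ 3"
  assumes a: "norm a = 1" and b: "norm b = 1" and ab: "a \<bullet> b = 0"
    and p: "p \<noteq> 0" and ap: "a \<bullet> p = 0" and bp: "b \<bullet> p = 0" and up: "u \<bullet> p = 0"
  shows "(a \<bullet> u) *\<^sub>R a + (b \<bullet> u) *\<^sub>R b = u"
proof (rule ccontr)
  \<comment> \<open>The residual \<open>w\<close> is orthogonal to \<open>a\<close>,
    \<open>b\<close> and \<open>p\<close>; were it nonzero, there would be four independent vectors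
    in dimension three.\<close>
  define w where "w = u - (a \<bullet> u) *\<^sub>R a - (b \<bullet> u) *\<^sub>R b"
  assume "(a \<bullet> u) *\<^sub>R a + (b \<bullet> u) *\<^sub>R b \<noteq> u"
  then have w: "w \<noteq> 0" by (auto simp: w_def algebra_simps)
  have n: "a \<bullet> a = 1" "b \<bullet> b = 1" using a b by (simp_all add: dot_square_norm)
  have o: "w \<bullet> a = 0" "w \<bullet> b = 0" "w \<bullet> p = 0"
    using n ab ap bp up by (simp_all add: w_def inner_diff_left inner_commute[of b a] inner_commute[of u])
  have d: "a \<noteq> b" "a \<noteq> p" "b \<noteq> p" "w \<noteq> a" "w \<noteq> b" "w \<noteq> p" "a \<noteq> 0" "b \<noteq> 0"
    using n ab ap bp o w p by auto
  have "independent {w, a, b, p}"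
    by (rule pairwise_orthogonal_independent)
      (use d w p o ab ap bp in \<open>auto simp: pairwise_def orthogonal_def inner_commute\<close>)
  then have "card {w, a, b, p} \<le> DIM(real ^ 3)"
    by (rule independent_bound[THEN conjunct2])
  with d show False by simp
qed

text \<open>The orthogonal projection of the third axis onto the plane normal to \<open>p\<close>.
  At \<open>p = 0\<close> division by zero yields \<open>0\<close>, leaving the axis itself.\<close>

definition transverse :: "real ^ 3 \<Rightarrow> real ^ 3"
  where "transverse p = axis 3 1 - (p $ 3 / (p \<bullet> p)) *\<^sub>R p"

lemma transverse_inner: "p \<noteq> 0 \<Longrightarrow> transverse p \<bullet> p = 0"
  by (simp add: transverse_def inner_diff_left inner_axis')

text \<open>The third axis and its projection differ by a multiple of \<open>p\<close>, to which the
  projection is orthogonal.\<close>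

lemma transverse_nth_3: "p \<noteq> 0 \<Longrightarrow> transverse p $ 3 = (norm (transverse p))\<^sup>2"
  unfolding power2_norm_eq_inner
  by (subst (2) transverse_def) (simp add: inner_diff_right inner_axis transverse_inner)

lemma norm_transverse_le_1: "norm (transverse p) \<le> 1"
proof (cases "p = 0")
  case False
  have "norm (transverse p) * norm (transverse p) \<le> norm (transverse p) * 1"
    using component_le_norm_cart[of "transverse p" 3] transverse_nth_3[OF False]
    by (simp add: power2_eq_square)
  then show ?thesis
    using mult_le_cancel_left_pos[of "norm (transverse p)"] by fastforce
qed (simp add: transverse_def)

text \<open>The squared norm is one minus the squared cosine of the angle between \<open>p\<close>
  and the third axis; the hypothesis keeps that squared cosine at most one half.\<close>

lemma norm_transverse_ge:
  assumes "\<bar>p $ 3\<bar> < p $ 1"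
  shows "1 / 2 \<le> (norm (transverse p))\<^sup>2"
proof -
  have p: "p \<noteq> 0" using assms by auto
  have "\<bar>p $ 3\<bar>\<^sup>2 \<le> (p $ 1)\<^sup>2"
    using assms by (intro power_mono) auto
  then have "p $ 3 * p $ 3 * 2 \<le> p \<bullet> p"
    by (simp add: inner_vec_def sum_3 power2_eq_square add_increasing2)
  moreover have "0 < p \<bullet> p" using p by simp
  ultimately have "p $ 3 / (p \<bullet> p) * p $ 3 \<le> 1 / 2"
    by (simp add: field_simps)
  then show ?thesis
    unfolding transverse_nth_3[OF p, symmetric] by (simp add: transverse_def)
qed

section \<open>Bounds on the spinors and the pair current for small wave vectors\<close>

lemma omega_bounds:
  assumes "0 < c" "0 < \<kappa>" "norm k \<le> \<kappa> / 2"
  shows "c * \<kappa> \<le> omega c \<kappa> k" "omega c \<kappa> k \<le> 2 * (c * \<kappa>)"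
proof -
  have "\<kappa> \<le> sqrt (\<kappa>\<^sup>2 + (norm k)\<^sup>2)"
    using assms by (intro real_le_rsqrt) simp
  then show "c * \<kappa> \<le> omega c \<kappa> k"
    using assms by (simp add: omega_def)
  have "(norm k)\<^sup>2 \<le> \<kappa>\<^sup>2"
    using assms by (intro power_mono) auto
  then have "\<kappa>\<^sup>2 + (norm k)\<^sup>2 \<le> 4 * \<kappa>\<^sup>2"
    using zero_le_power2[of \<kappa>] by linarith
  then have "sqrt (\<kappa>\<^sup>2 + (norm k)\<^sup>2) \<le> 2 * \<kappa>"
    using assms by (intro real_le_lsqrt) (simp_all add: power_divide power_mult_distrib)
  then show "omega c \<kappa> k \<le> 2 * (c * \<kappa>)"
    using assms by (simp add: omega_def)
qed

lemma spinor_up_bounds: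
  assumes "0 < c" "0 < \<kappa>" "norm k \<le> \<kappa> / 2"
  shows "2 * (c * \<kappa>) \<le> spinor_up c \<kappa> k" "spinor_up c \<kappa> k \<le> 3 * (c * \<kappa>)"
  using omega_bounds[OF assms] by (simp_all add: spinor_up_def mult.commute)

lemma spinor_norm_bounds:
  assumes "0 < c" "0 < \<kappa>" "norm k \<le> \<kappa> / 2"
  shows "1 / (sqrt 6 * (c * \<kappa>)) \<le> spinor_norm c \<kappa> k" "spinor_norm c \<kappa> k \<le> 1 / (c * \<kappa>)"
proof -
  note b = omega_bounds[OF assms] spinor_up_bounds[OF assms]
  have ck: "0 < c * \<kappa>" using assms by simp
  have "omega c \<kappa> k * spinor_up c \<kappa> k \<le> (2 * (c * \<kappa>)) * (3 * (c * \<kappa>))"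
    using b ck by (intro mult_mono) auto
  then have "sqrt (omega c \<kappa> k * spinor_up c \<kappa> k) \<le> sqrt (6 * (c * \<kappa>)\<^sup>2)"
    by (simp add: power2_eq_square)
  also have "\<dots> = sqrt 6 * (c * \<kappa>)"
    using ck by (simp add: real_sqrt_mult)
  finally have u: "sqrt (omega c \<kappa> k * spinor_up c \<kappa> k) \<le> sqrt 6 * (c * \<kappa>)" .
  have "(c * \<kappa>) * (c * \<kappa>) \<le> omega c \<kappa> k * spinor_up c \<kappa> k"
    using b ck by (intro mult_mono) auto
  then have l: "c * \<kappa> \<le> sqrt (omega c \<kappa> k * spinor_up c \<kappa> k)"
    by (simp add: real_le_rsqrt power2_eq_square)
  show "1 / (sqrt 6 * (c * \<kappa>)) \<le> spinor_norm c \<kappa> k" "spinor_norm c \<kappa> k \<le> 1 / (c * \<kappa>)"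
    unfolding spinor_norm_def using u l ck order.strict_trans2[OF ck l]
    by (auto simp del: real_sqrt_gt_0_iff simp: real_sqrt_gt_zero intro!: divide_left_mono mult_pos_pos)
qed

text \<open>In units of \<open>z\<close>, the leading coefficient \<open>W\<close> lies between 4
  and 9, the scalar product contributes at most 1/4 and the two mixed terms together at most 1/2.
  The leading term thus controls both the size and the direction of the current.\<close>

lemma pair_current_bounds:
  assumes c: "0 < c" "0 < \<kappa>" and k: "norm k \<le> \<kappa> / 2" "norm k' \<le> \<kappa> / 2"
  shows "norm (pair_current c \<kappa> k k') \<le> 10"
    and "\<bar>p $ 3\<bar> < p $ 1 \<Longrightarrow> 1 / 6 \<le> pair_current c \<kappa> k k' \<bullet> sgn (transverse p)"
proof -
  define W where "W = spinor_up c \<kappa> k * spinor_up c \<kappa> k'"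
  define n where "n = spinor_norm c \<kappa> k * spinor_norm c \<kappa> k'"
  define z where "z = (c * \<kappa>)\<^sup>2"
  have ck: "0 < c * \<kappa>" and z0: "0 < z" using c by (simp_all add: z_def)
  note u = spinor_up_bounds[OF c k(1)] spinor_up_bounds[OF c k(2)]
  note s = spinor_norm_bounds[OF c k(1)] spinor_norm_bounds[OF c k(2)]
  have "(2 * (c * \<kappa>)) * (2 * (c * \<kappa>)) \<le> W" "W \<le> (3 * (c * \<kappa>)) * (3 * (c * \<kappa>))"
    unfolding W_def using u ck by (intro mult_mono; linarith)+
  then have W: "4 * z \<le> W" "W \<le> 9 * z"
    by (simp_all add: z_def power2_eq_square)
  have "(1 / (sqrt 6 * (c * \<kappa>))) * (1 / (sqrt 6 * (c * \<kappa>))) \<le> n"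
    unfolding n_def using s ck by (intro mult_mono) (auto intro: order_trans[rotated])
  moreover have "(1 / (sqrt 6 * (c * \<kappa>))) * (1 / (sqrt 6 * (c * \<kappa>))) = 1 / (6 * z)"
    by (simp add: z_def power2_eq_square)
  moreover have "n \<le> (1 / (c * \<kappa>)) * (1 / (c * \<kappa>))"
    unfolding n_def using s ck by (intro mult_mono) (auto intro: order_trans[rotated])
  moreover have "(1 / (c * \<kappa>)) * (1 / (c * \<kappa>)) = 1 / z"
    by (simp add: z_def power2_eq_square)
  ultimately have n: "1 / (6 * z) \<le> n" "n \<le> 1 / z" by simp_all
  have n0: "0 < n" using n(1) z0 by (auto intro: less_le_trans[rotated])
  have kk: "norm x * norm y \<le> \<kappa>\<^sup>2 / 4" if "norm x \<le> \<kappa> / 2" "norm y \<le> \<kappa> / 2" for x y :: "real ^ 3"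
    using mult_mono[OF that] c by (simp add: power2_eq_square)
  have q: "c\<^sup>2 * r \<le> z / 4" if "r \<le> \<kappa>\<^sup>2 / 4" for r
    using mult_left_mono[OF that, of "c\<^sup>2"] by (simp add: z_def power_mult_distrib)
  have kk': "c\<^sup>2 * \<bar>k \<bullet> k'\<bar> \<le> z / 4"
    by (rule q, rule order_trans[OF Cauchy_Schwarz_ineq2 kk[OF k]])
  have c3: "c\<^sup>2 * \<bar>x $ 3 * (y \<bullet> t)\<bar> \<le> z / 4"
    if "norm x \<le> \<kappa> / 2" "norm y \<le> \<kappa> / 2" "norm t \<le> 1" for x y t :: "real ^ 3"
  proof (rule q)
    have "\<bar>y \<bullet> t\<bar> \<le> norm y * 1"
      using Cauchy_Schwarz_ineq2[of y t] mult_left_mono[OF that(3), of "norm y"] by simp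
    then have "\<bar>x $ 3\<bar> * \<bar>y \<bullet> t\<bar> \<le> norm x * norm y"
      using component_le_norm_cart[of x 3] by (intro mult_mono) auto
    then show "\<bar>x $ 3 * (y \<bullet> t)\<bar> \<le> \<kappa>\<^sup>2 / 4"
      using kk[OF that(1,2)] by (simp add: abs_mult)
  qed
  have J: "pair_current c \<kappa> k k' \<bullet> t =
      n * ((W - c\<^sup>2 * (k \<bullet> k')) * t $ 3 + (c\<^sup>2 * (k $ 3 * (k' \<bullet> t)) + c\<^sup>2 * (k' $ 3 * (k \<bullet> t))))" for t
    by (simp add: pair_current_def n_def W_def inner_add_left inner_axis' algebra_simps)
  have c3': "\<bar>c\<^sup>2 * (k $ 3 * (k' \<bullet> t)) + c\<^sup>2 * (k' $ 3 * (k \<bullet> t))\<bar> \<le> z / 2" if "norm t \<le> 1" for t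
    using c3[OF k that] c3[OF k(2,1) that]
      abs_triangle_ineq[of "c\<^sup>2 * (k $ 3 * (k' \<bullet> t))" "c\<^sup>2 * (k' $ 3 * (k \<bullet> t))"]
    by (simp only: abs_mult[of "c\<^sup>2"] abs_power2)
  have kk'': "\<bar>c\<^sup>2 * (k \<bullet> k')\<bar> \<le> z / 4" using kk' by (simp add: abs_mult)
  show "norm (pair_current c \<kappa> k k') \<le> 10"
  proof -
    \<comment> \<open>Testing against the current's own direction turns the norm into an inner
      product; the coefficient 37/4 below is 9 + 1/4, and 37/4 + 1/2 is at most 10.\<close>
    define t where "t = sgn (pair_current c \<kappa> k k')"
    have t: "norm t \<le> 1" by (simp add: t_def norm_sgn)
    have t3: "\<bar>t $ 3\<bar> \<le> 1" using component_le_norm_cart[of t 3] t by linarith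
    have "\<bar>(W - c\<^sup>2 * (k \<bullet> k')) * t $ 3\<bar> \<le> (37 / 4 * z) * 1"
      unfolding abs_mult using W kk'' t3 by (intro mult_mono) auto
    then have "(W - c\<^sup>2 * (k \<bullet> k')) * t $ 3 + (c\<^sup>2 * (k $ 3 * (k' \<bullet> t)) + c\<^sup>2 * (k' $ 3 * (k \<bullet> t))) \<le> 10 * z"
      using c3'[OF t] z0 by linarith
    then have "pair_current c \<kappa> k k' \<bullet> t \<le> (1 / z) * (10 * z)"
      unfolding J using n0 n z0 by (intro order_trans[OF mult_left_mono mult_right_mono]) auto
    moreover have "pair_current c \<kappa> k k' \<bullet> t = norm (pair_current c \<kappa> k k')"
      by (cases "pair_current c \<kappa> k k' = 0") (simp_all add: t_def sgn_div_norm dot_square_norm power2_eq_square)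
    ultimately show ?thesis using z0 by simp
  qed
  show "1 / 6 \<le> pair_current c \<kappa> k k' \<bullet> sgn (transverse p)" if p: "\<bar>p $ 3\<bar> < p $ 1"
  proof -
    define t where "t = transverse p"
    have p0: "p \<noteq> 0" using p by auto
    have t: "norm t \<le> 1" by (simp add: t_def norm_transverse_le_1)
    have t3: "1 / 2 \<le> t $ 3" using norm_transverse_ge[OF p] transverse_nth_3[OF p0] by (simp add: t_def)
    \<comment> \<open>Here 15/4 is 4 - 1/4. After halving and subtracting the mixed terms, 11/8 of
      \<open>z\<close> remains, more than enough for \<open>z\<close>.\<close>
    have "(15 / 4 * z) * (1 / 2) \<le> (W - c\<^sup>2 * (k \<bullet> k')) * t $ 3"
      using W kk'' t3 z0 by (intro mult_mono) auto
    then have "z \<le> (W - c\<^sup>2 * (k \<bullet> k')) * t $ 3 + (c\<^sup>2 * (k $ 3 * (k' \<bullet> t)) + c\<^sup>2 * (k' $ 3 * (k \<bullet> t)))"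
      using c3'[OF t] z0 by linarith
    then have "(1 / (6 * z)) * z \<le> pair_current c \<kappa> k k' \<bullet> t"
      unfolding J using n z0 by (intro mult_mono) auto
    then have 6: "1 / 6 \<le> pair_current c \<kappa> k k' \<bullet> t" using z0 by simp
    \<comment> \<open>Passing from \<open>t\<close> to its unit vector only enlarges the inner
      product, because \<open>norm t\<close> is at most 1.\<close>
    have "0 < norm t" using t3 by auto
    with t have "1 \<le> 1 / norm t" by simp
    with 6 have "1 / 6 * 1 \<le> (pair_current c \<kappa> k k' \<bullet> t) * (1 / norm t)"
      by (intro mult_mono) auto
    also have "\<dots> = pair_current c \<kappa> k k' \<bullet> sgn t"
      by (simp only: sgn_div_norm inner_scaleR_right divide_inverse mult_1_left mult.commute)
    finally show ?thesis by (simp add: t_def)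
  qed
qed

subsection \<open>The trial states\<close>

definition trial_state :: "real \<Rightarrow> real \<Rightarrow> real \<Rightarrow> real \<Rightarrow> fock"
  where "trial_state x y h v = (\<lambda>p.
    if p = (0, 0) then x *\<^sub>R axis {} 1 + y *\<^sub>R axis {2, 3} 1
    else if p = (1, 0) then h *\<^sub>R axis {1, 4} 1
    else if p = (0, 1) then v *\<^sub>R axis {1, 4} 1 else 0)"

lemma trial_state_simps [simp]:
  "trial_state x y h v (0, 0) = x *\<^sub>R axis {} 1 + y *\<^sub>R axis {2, 3} 1"
  "trial_state x y h v (Suc 0, 0) = h *\<^sub>R axis {1, 4} 1"
  "trial_state x y h v (0, Suc 0) = v *\<^sub>R axis {1, 4} 1"
  "1 < m + n \<Longrightarrow> trial_state x y h v (m, n) = 0"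
  by (auto simp: trial_state_def)

lemma infsum_low_photon_number:
  fixes F :: "nat \<times> nat \<Rightarrow> 'a :: {topological_comm_monoid_add, t2_space}"
  assumes "\<And>m n. 1 < m + n \<Longrightarrow> F (m, n) = 0"
  shows "infsum F UNIV = F (0, 0) + F (1, 0) + F (0, 1)"
proof -
  have "F p = 0" if "p \<notin> {(0, 0), (1, 0), (0, 1)}" for p
  proof (cases p)
    case (Pair m n)
    with that have "1 < m + n" by (cases m; cases n) auto
    then show ?thesis using assms Pair by simp
  qed
  then have "infsum F UNIV = infsum F {(0, 0), (1, 0), (0, 1)}"
    by (intro infsum_cong_neutral) auto
  then show ?thesis by (simp add: add.assoc)
qed

lemma finite_photon_number_in_fock_space:
  assumes "\<And>m n. N < m + n \<Longrightarrow> \<Psi> (m, n) = 0"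
  shows "\<Psi> \<in> fock_space"
proof -
  have "{p. \<Psi> p \<noteq> 0} \<subseteq> {..N} \<times> {..N}"
  proof
    fix p assume "p \<in> {p. \<Psi> p \<noteq> 0}"
    then have "\<not> N < fst p + snd p" using assms[of "fst p" "snd p"] by auto
    then show "p \<in> {..N} \<times> {..N}" by (cases p) auto
  qed
  then have "finite {p. \<Psi> p \<noteq> 0}" by (rule finite_subset) simp
  then show ?thesis
    unfolding fock_space_def mem_Collect_eq
    by (intro finite_nonzero_values_imp_summable_on) simp
qed

lemma norm_sum_axis:
  "(norm (x *\<^sub>R axis S (1::complex) + y *\<^sub>R axis T 1))\<^sup>2 = x\<^sup>2 + y\<^sup>2" if "S \<noteq> T"
  using that by (simp add: power2_norm_eq_inner inner_add_left inner_add_right inner_axis_axis) (simp add: power2_eq_square)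

lemma fock_norm_trial_state: "fock_norm (trial_state x y h v) = sqrt (x\<^sup>2 + y\<^sup>2 + h\<^sup>2 + v\<^sup>2)"
  unfolding fock_norm_def
  by (subst infsum_low_photon_number)
    (simp_all add: norm_sum_axis power_mult_distrib)

lemma cinner_simps:
  "cinner (v + w) u = cinner v u + cinner w u"
  "cinner (a *\<^sub>R v) u = complex_of_real a * cinner v u"
  "cinner (axis i 1) u = u $ i"
  "cinner 0 u = 0"
proof -
  have "cnj (axis i 1 $ j) * u $ j = (if j = i then u $ i else 0)" for j
    by (simp add: axis_def)
  then show "cinner (axis i 1) u = u $ i" by (simp add: cinner_def)
qed (simp_all add: cinner_def distrib_right sum.distrib sum_distrib_left scaleR_conv_of_real[where 'a=complex] mult.assoc)

lemma fock_inner_trial_state: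
  "fock_inner (trial_state x y h v) \<Phi> =
    x * \<Phi> (0, 0) $ {} + y * \<Phi> (0, 0) $ {2, 3} + h * \<Phi> (1, 0) $ {1, 4} + v * \<Phi> (0, 1) $ {1, 4}"
  unfolding fock_inner_def
  by (subst infsum_low_photon_number) (simp_all add: cinner_simps)

section \<open>Action of the Hamiltonians on trial states\<close>

lemma a_dag_a:
  "a_H_dag (a_H \<Psi>) (m, n) = real m *\<^sub>R \<Psi> (m, n)"
  "a_V_dag (a_V \<Psi>) (m, n) = real n *\<^sub>R \<Psi> (m, n)"
proof -
  have "sqrt (real m) * sqrt (real (m - 1 + 1)) = real m" for m
    by (cases m) (simp_all flip: real_sqrt_mult)
  \<comment> \<open>Truncated subtraction gives the wrong index at photon number zero, where the
    coefficient vanishes.\<close>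
  moreover have "real m *\<^sub>R \<Psi> (m - 1 + 1, n) = real m *\<^sub>R \<Psi> (m, n)"
    "real n *\<^sub>R \<Psi> (m, n - 1 + 1) = real n *\<^sub>R \<Psi> (m, n)"
    by (cases m; simp) (cases n; simp)
  ultimately show "a_H_dag (a_H \<Psi>) (m, n) = real m *\<^sub>R \<Psi> (m, n)"
    "a_V_dag (a_V \<Psi>) (m, n) = real n *\<^sub>R \<Psi> (m, n)"
    by (simp_all only: a_H_dag_def a_H_def a_V_dag_def a_V_def prod.case scaleR_scaleR)
qed

lemma H_ph_nth: "H_ph hbar c \<psi> kph k (m, n) = (hbar * c * norm kph * real (m + n)) *\<^sub>R \<psi> kph k (m, n)"
  by (simp add: H_ph_def a_dag_a scaleR_add_left[symmetric])

lemma number_operator_nth: "((\<Sum>s\<in>UNIV. phi_dag s ** phi s) *v w) $ S = of_nat (card S) * w $ S"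
proof -
  have "(phi_dag s ** phi s) $ S $ T = (if T = S then if s \<in> S then 1 else 0 else 0)" for s T
    by (auto simp: phi_dag_mult_nth phi_nth jw_sign_same jw_sign_square insert_absorb)
  then have "(\<Sum>s\<in>UNIV. phi_dag s ** phi s) $ S $ T = (if T = S then of_nat (card S) else 0)" for T
    by (simp add: sum.If_cases)
  then have "(\<Sum>s\<in>UNIV. phi_dag s ** phi s) $ S $ T * w $ T = (if T = S then of_nat (card S) * w $ S else 0)" for T
    by simp
  then show ?thesis by (simp add: matrix_vector_mult_def del: sum_component)
qed

lemma H_el_nth: "H_el hbar c \<kappa> \<psi> kph k p $ S = of_real (hbar * omega c \<kappa> k) * of_nat (card S) * \<psi> kph k p $ S"
  unfolding H_el_def vector_scaleR_component number_operator_nth by (simp add: scaleR_conv_of_real[where 'a=complex])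

lemma pair_neq: "{1, 4::4} \<noteq> {2, 3}" "{2, 3::4} \<noteq> {1, 4}"
  by (simp_all add: doubleton_eq_iff)

lemma matrix_vector_axis: "(M *v axis S (1::complex)) $ U = M $ U $ S"
proof -
  have "M $ U $ T * axis S 1 $ T = (if T = S then M $ U $ S else 0)" for T
    by (simp add: axis_def)
  then show ?thesis by (simp add: matrix_vector_mult_def)
qed

lemma matrix_vector_state:
  fixes M :: fermi_op
  shows "(M *v (x *\<^sub>R axis S 1 + y *\<^sub>R axis T 1)) $ U = x * M $ U $ S + y * M $ U $ T"
    "(M *v (x *\<^sub>R axis S 1)) $ U = x * M $ U $ S"
proof -
  have s: "M *v (x *\<^sub>R w) = complex_of_real x *s (M *v w)" for x and w :: fermi
    by (simp add: vec_eq_iff matrix_vector_mult_def sum_distrib_left scaleR_conv_of_real[where 'a=complex] ac_simps)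
  then show "(M *v (x *\<^sub>R axis S 1 + y *\<^sub>R axis T 1)) $ U = x * M $ U $ S + y * M $ U $ T"
    "(M *v (x *\<^sub>R axis S 1)) $ U = x * M $ U $ S"
    by (simp_all add: matrix_vector_right_distrib matrix_vector_axis)
qed

text \<open>Vacuum and pair are linked only by two creators or two annihilators, while
  \<open>{1, 4}\<close> and \<open>{2, 3}\<close> differ in all four occupation numbers.\<close>

lemma J_part_zero:
  assumes "\<eta> \<in> {1, - 1}" "\<theta> \<in> {1, - 1}"
  shows "(\<eta>, \<theta>) \<noteq> (- 1, - 1) \<Longrightarrow> J_part c \<kappa> G \<eta> \<theta> k k' $ {1, 4} $ {} = 0"
    "(\<eta>, \<theta>) \<noteq> (1, 1) \<Longrightarrow> J_part c \<kappa> G \<eta> \<theta> k k' $ {} $ {1, 4} = 0"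
    "J_part c \<kappa> G \<eta> \<theta> k k' $ {1, 4} $ {2, 3} = 0"
    "J_part c \<kappa> G \<eta> \<theta> k k' $ {2, 3} $ {1, 4} = 0"
proof -
  have "(1::4) \<in> {1, 4} - {2, 3}" "(4::4) \<in> {1, 4} - {2, 3}" "(1::4) \<noteq> 4"
    "(2::4) \<in> {2, 3} - {1, 4}" "(3::4) \<in> {2, 3} - {1, 4}" "(2::4) \<noteq> 3" by simp_all
  note t = transfer_pair_nth[OF this(1-4)] transfer_pair_nth[OF this(4-6) this(1)]
  show "J_part c \<kappa> G \<eta> \<theta> k k' $ {1, 4} $ {2, 3} = 0" "J_part c \<kappa> G \<eta> \<theta> k k' $ {2, 3} $ {1, 4} = 0"
    by (rule J_part_nth_eq_0; (rule t assms))+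
  show "J_part c \<kappa> G \<eta> \<theta> k k' $ {1, 4} $ {} = 0" if "(\<eta>, \<theta>) \<noteq> (- 1, - 1)"
    by (rule J_part_nth_eq_0) (use that assms create_pair_nth in auto)
  show "J_part c \<kappa> G \<eta> \<theta> k k' $ {} $ {1, 4} = 0" if "(\<eta>, \<theta>) \<noteq> (1, 1)"
    by (rule J_part_nth_eq_0) (use that assms annihilate_pair_nth in auto)
qed

lemma A_part_nth:
  "A_part lam \<epsilon>H \<epsilon>V \<zeta> \<alpha> kph \<Psi> p $ S =
    complex_of_real (lam / 2 * \<epsilon>H kph $ \<alpha>) * (if \<zeta> = 1 then a_H \<Psi> p else a_H_dag \<Psi> p) $ S +
    complex_of_real (lam / 2 * \<epsilon>V kph $ \<alpha>) * (if \<zeta> = 1 then a_V \<Psi> p else a_V_dag \<Psi> p) $ S"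
  by (simp add: A_part_def)

text \<open>Among the eight sign patterns only two survive between components of trial states: all
  signs \<open>+1\<close> destroy photon and pair together, all signs \<open>-1\<close> create them
  together. The amplitude \<open>y\<close> never contributes.\<close>

lemma interaction_part_nth:
  fixes \<epsilon>H \<epsilon>V :: "real ^ 3 \<Rightarrow> real ^ 3" and kph k k' :: "real ^ 3" and c \<kappa> lam x y h v :: real
  assumes "\<zeta> \<in> {1, - 1}" "\<eta> \<in> {1, - 1}" "\<theta> \<in> {1, - 1}"
  defines "\<Phi> \<equiv> \<lambda>p. \<Sum>\<alpha>\<in>UNIV. A_part lam \<epsilon>H \<epsilon>V \<zeta> \<alpha> kph
    (\<lambda>p'. J_part c \<kappa> (gamma \<alpha>) \<eta> \<theta> k k' *v trial_state x y h v p') p"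
  shows "\<Phi> (0, 0) $ {} = (if \<zeta> = 1 \<and> \<eta> = 1 \<and> \<theta> = 1 then
      lam / 2 * (pair_current c \<kappa> k k' \<bullet> (h *\<^sub>R \<epsilon>H kph + v *\<^sub>R \<epsilon>V kph)) else 0)"
    "\<Phi> (0, 0) $ {2, 3} = 0"
    "\<Phi> (1, 0) $ {1, 4} = (if \<zeta> = - 1 \<and> \<eta> = - 1 \<and> \<theta> = - 1 then
      lam / 2 * (pair_current c \<kappa> k k' \<bullet> (x *\<^sub>R \<epsilon>H kph)) else 0)"
    "\<Phi> (0, 1) $ {1, 4} = (if \<zeta> = - 1 \<and> \<eta> = - 1 \<and> \<theta> = - 1 then
      lam / 2 * (pair_current c \<kappa> k k' \<bullet> (x *\<^sub>R \<epsilon>V kph)) else 0)"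
proof -
  note z = J_part_zero[OF assms(2,3)]
  have j: "J_part c \<kappa> (gamma \<alpha>) \<eta> \<theta> k k' $ {1, 4} $ {} =
      (if \<eta> = - 1 \<and> \<theta> = - 1 then complex_of_real (pair_current c \<kappa> k k' $ \<alpha>) else 0)"
    "J_part c \<kappa> (gamma \<alpha>) \<eta> \<theta> k k' $ {} $ {1, 4} =
      (if \<eta> = 1 \<and> \<theta> = 1 then complex_of_real (pair_current c \<kappa> k k' $ \<alpha>) else 0)" for \<alpha>
    using z(1,2)[of c \<kappa> "gamma \<alpha>" k k'] J_part_pair[of c \<kappa> \<alpha> k k'] by auto
  note s = A_part_nth a_H_def a_V_def a_H_dag_def a_V_dag_def matrix_vector_state j J_part_pair z(3,4) J_part_zero(3)[of "- 1" "- 1", simplified]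
    inner_vec_def sum_distrib_left
  show "\<Phi> (0, 0) $ {} = (if \<zeta> = 1 \<and> \<eta> = 1 \<and> \<theta> = 1 then
      lam / 2 * (pair_current c \<kappa> k k' \<bullet> (h *\<^sub>R \<epsilon>H kph + v *\<^sub>R \<epsilon>V kph)) else 0)"
    using assms(1) unfolding \<Phi>_def
    by (auto simp: s intro!: sum.cong) (simp_all add: algebra_simps)
  show "\<Phi> (0, 0) $ {2, 3} = 0"
    using assms(1) unfolding \<Phi>_def by (auto simp: s)
  show "\<Phi> (1, 0) $ {1, 4} = (if \<zeta> = - 1 \<and> \<eta> = - 1 \<and> \<theta> = - 1 then
      lam / 2 * (pair_current c \<kappa> k k' \<bullet> (x *\<^sub>R \<epsilon>H kph)) else 0)"
    using assms(1) unfolding \<Phi>_def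
    by (auto simp: s intro!: sum.cong)
  show "\<Phi> (0, 1) $ {1, 4} = (if \<zeta> = - 1 \<and> \<eta> = - 1 \<and> \<theta> = - 1 then
      lam / 2 * (pair_current c \<kappa> k k' \<bullet> (x *\<^sub>R \<epsilon>V kph)) else 0)"
    using assms(1) unfolding \<Phi>_def
    by (auto simp: s intro!: sum.cong)
qed

text \<open>Both surviving patterns fix the same partner wave vector \<open>- kph - k\<close>. One
  term pairs the vacuum amplitude at \<open>k\<close> with the photon amplitudes at the partner, the
  other does the reverse.\<close>

lemma fock_inner_H_I:
  fixes x y h v :: "real ^ 3 \<Rightarrow> real ^ 3 \<Rightarrow> real"
  defines "\<psi> \<equiv> \<lambda>kph k. trial_state (x kph k) (y kph k) (h kph k) (v kph k)"
  shows "fock_inner (\<psi> kph k) (H_I q c \<kappa> lam \<epsilon>H \<epsilon>V \<psi> kph k) = complex_of_real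
    (q * c * (lam / 2) * (pair_current c \<kappa> k (- kph - k) \<bullet>
      (x kph k *\<^sub>R (h kph (- kph - k) *\<^sub>R \<epsilon>H kph + v kph (- kph - k) *\<^sub>R \<epsilon>V kph) +
       x kph (- kph - k) *\<^sub>R (h kph k *\<^sub>R \<epsilon>H kph + v kph k *\<^sub>R \<epsilon>V kph))))"
proof -
  let ?k' = "- kph - k"
  let ?J = "pair_current c \<kappa> k ?k'"
  define F where "F \<zeta> \<eta> \<theta> = (\<lambda>p. \<Sum>\<alpha>\<in>UNIV. A_part lam \<epsilon>H \<epsilon>V \<zeta> \<alpha> kph
    (\<lambda>p'. J_part c \<kappa> (gamma \<alpha>) \<eta> \<theta> k (- \<theta> *\<^sub>R (\<zeta> *\<^sub>R kph + \<eta> *\<^sub>R k)) *v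
      \<psi> kph (- \<theta> *\<^sub>R (\<zeta> *\<^sub>R kph + \<eta> *\<^sub>R k)) p') p)" for \<zeta> \<eta> \<theta>
  have H: "H_I q c \<kappa> lam \<epsilon>H \<epsilon>V \<psi> kph k p $ S =
      complex_of_real (q * c) * (\<Sum>\<zeta>\<in>{1, -1}. \<Sum>\<eta>\<in>{1, -1}. \<Sum>\<theta>\<in>{1, -1}. F \<zeta> \<eta> \<theta> p $ S)" for p S
    unfolding H_I_def Let_def F_def vector_scaleR_component sum_component
    by (simp only: scaleR_conv_of_real[where 'a=complex])
  have k': "- (- 1) *\<^sub>R ((- 1) *\<^sub>R kph + (- 1) *\<^sub>R k) = ?k'" "- 1 *\<^sub>R (1 *\<^sub>R kph + 1 *\<^sub>R k) = ?k'"
    by simp_all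
  have F: "F \<zeta> \<eta> \<theta> (0, 0) $ {} = (if \<zeta> = 1 \<and> \<eta> = 1 \<and> \<theta> = 1 then
      lam / 2 * (?J \<bullet> (h kph ?k' *\<^sub>R \<epsilon>H kph + v kph ?k' *\<^sub>R \<epsilon>V kph)) else 0)"
    "F \<zeta> \<eta> \<theta> (0, 0) $ {2, 3} = 0"
    "F \<zeta> \<eta> \<theta> (1, 0) $ {1, 4} = (if \<zeta> = - 1 \<and> \<eta> = - 1 \<and> \<theta> = - 1 then
      lam / 2 * (?J \<bullet> (x kph ?k' *\<^sub>R \<epsilon>H kph)) else 0)"
    "F \<zeta> \<eta> \<theta> (0, 1) $ {1, 4} = (if \<zeta> = - 1 \<and> \<eta> = - 1 \<and> \<theta> = - 1 then
      lam / 2 * (?J \<bullet> (x kph ?k' *\<^sub>R \<epsilon>V kph)) else 0)"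
    if "\<zeta> \<in> {1, - 1}" "\<eta> \<in> {1, - 1}" "\<theta> \<in> {1, - 1}" for \<zeta> \<eta> \<theta>
    unfolding F_def \<psi>_def interaction_part_nth[OF that] by (auto simp: k')
  have I: "fock_inner (\<psi> kph k) \<Phi> = x kph k * \<Phi> (0, 0) $ {} + y kph k * \<Phi> (0, 0) $ {2, 3} +
      h kph k * \<Phi> (1, 0) $ {1, 4} + v kph k * \<Phi> (0, 1) $ {1, 4}" for \<Phi>
    unfolding \<psi>_def by (rule fock_inner_trial_state)
  show ?thesis
    unfolding I H
    by (simp add: F F[unfolded One_nat_def]) (simp add: inner_add_right algebra_simps)
qed

text \<open>The vector potential changes the photon number by one, so at most two photons
  occur.\<close>

lemma H_I_in_fock_space:
  fixes x y h v :: "real ^ 3 \<Rightarrow> real ^ 3 \<Rightarrow> real"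
  shows "H_I q c \<kappa> lam \<epsilon>H \<epsilon>V (\<lambda>kph k. trial_state (x kph k) (y kph k) (h kph k) (v kph k)) kph k \<in> fock_space"
proof (rule finite_photon_number_in_fock_space[of 2])
  fix m n :: nat
  assume mn: "2 < m + n"
  have "A_part lam \<epsilon>H \<epsilon>V \<zeta> \<alpha> kph (\<lambda>p'. M *v trial_state x y h v p') (m, n) = 0" for \<zeta> \<alpha> kph M x y h v
  proof -
    have "trial_state x y h v (m + 1, n) = 0" "trial_state x y h v (m, n + 1) = 0"
      "m \<noteq> 0 \<Longrightarrow> trial_state x y h v (m - 1, n) = 0" "n \<noteq> 0 \<Longrightarrow> trial_state x y h v (m, n - 1) = 0"
      using mn by (auto intro!: trial_state_simps(4))
    then show ?thesis
      by (cases "m = 0"; cases "n = 0") (simp_all add: A_part_def a_H_def a_V_def a_H_dag_def a_V_dag_def)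
  qed
  then show "H_I q c \<kappa> lam \<epsilon>H \<epsilon>V (\<lambda>kph k. trial_state (x kph k) (y kph k) (h kph k) (v kph k)) kph k (m, n) = 0"
    by (simp add: H_I_def Let_def)
qed

section \<open>Measurability, and a criterion for negative integrals\<close>

lemma borel_measurable_vec_nth [measurable (raw)]:
  fixes f :: "'a \<Rightarrow> real ^ 'n"
  assumes "f \<in> borel_measurable M"
  shows "(\<lambda>x. f x $ i) \<in> borel_measurable M"
proof -
  have "(\<lambda>x. f x \<bullet> axis i 1) \<in> borel_measurable M" using assms by measurable
  then show ?thesis by (simp add: inner_axis)
qed

lemma borel_measurable_spinor_up [measurable]: "spinor_up c \<kappa> \<in> borel_measurable borel"
  unfolding spinor_up_def[abs_def] omega_def by measurable

lemma borel_measurable_spinor_norm [measurable]: "spinor_norm c \<kappa> \<in> borel_measurable borel"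
  unfolding spinor_norm_def[abs_def] omega_def by measurable

lemma borel_measurable_pair_current [measurable (raw)]:
  assumes [measurable]: "f \<in> borel_measurable M" "g \<in> borel_measurable M"
  shows "(\<lambda>x. pair_current c \<kappa> (f x) (g x)) \<in> borel_measurable M"
  unfolding pair_current_def by measurable

lemma borel_measurable_transverse [measurable]: "transverse \<in> borel_measurable borel"
  unfolding transverse_def[abs_def] by measurable

text \<open>A nonpositive integrable function with zero integral vanishes almost everywhere, which
  is impossible on a set of nonzero measure where it is negative.\<close>

lemma integral_neg:
  fixes f :: "'a \<Rightarrow> real"
  assumes f: "integrable M f" "\<And>x. f x \<le> 0"
    and A: "A \<in> sets M" "emeasure M A \<noteq> 0" "\<And>x. x \<in> A \<Longrightarrow> f x < 0"
  shows "integral\<^sup>L M f < 0"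
proof -
  have "integral\<^sup>L M f \<noteq> 0"
  proof
    assume "integral\<^sup>L M f = 0"
    then have "AE x in M. - f x = 0"
      using integral_nonneg_eq_0_iff_AE[of M "\<lambda>x. - f x"] f by simp
    then have "AE x in M. x \<notin> A"
      by eventually_elim (use A(3) in force)
    then have "emeasure M {x \<in> space M. x \<in> A} = 0"
      using A(1) by (subst (asm) AE_iff_measurable[OF _ refl]) auto
    moreover have "{x \<in> space M. x \<in> A} = A"
      using sets.sets_into_space[OF A(1)] by auto
    ultimately show False using A(2) by simp
  qed
  moreover have "integral\<^sup>L M f \<le> 0"
    using integral_nonneg_AE[of "\<lambda>x. - f x" M] f by simp
  ultimately show ?thesis by simp
qed

text \<open>The function \<open>b\<close> is the pair amplitude at each electron wave vector. The
  value of \<open>d\<close> keeps the relevant wave vectors within the range of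
  \<open>pair_current_bounds\<close>, \<open>b_le\<close> leaves a vacuum amplitude of at least one
  half, and \<open>b_small\<close> makes the photon energy smaller than the interaction
  energy.\<close>

locale pair_trial =
  fixes hbar c \<kappa> lam q d :: real and \<epsilon>H \<epsilon>V :: "real ^ 3 \<Rightarrow> real ^ 3" and b :: "real ^ 3 \<Rightarrow> real"
  assumes pos: "0 < hbar" "0 < c" "0 < \<kappa>" "0 < lam" "q \<noteq> 0" and d: "d = \<kappa> / 8"
    and pol: "polarization \<epsilon>H \<epsilon>V"
    and b_measurable [measurable]: "b \<in> borel_measurable borel"
    and b_pos: "\<And>k. 0 < b k" and b_le: "\<And>k. b k \<le> 1 / 2"
    and b_small: "\<And>k. hbar * (3 / 2 * d) * b k < \<bar>q\<bar> * lam / 24"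
begin

text \<open>Centre and radius keep the first component above \<open>d / 2\<close> and the third
  below it in modulus, so \<open>P\<close> avoids the third axis and the origin.\<close>

definition P :: "(real ^ 3) set" where "P = ball (d *\<^sub>R axis 1 1) (d / 2)"
definition K :: "(real ^ 3) set" where "K = ball 0 d"

lemma sets_P_K [measurable]: "P \<in> sets borel" "K \<in> sets borel"
  by (simp_all add: P_def K_def)

lemma d_pos: "0 < d" using pos d by simp

definition u :: "real ^ 3 \<Rightarrow> real ^ 3" where "u kph = sgn (transverse kph)"

lemma u_measurable [measurable]: "u \<in> borel_measurable borel"
  unfolding u_def[abs_def] by measurable

definition X :: "real ^ 3 \<Rightarrow> real ^ 3 \<Rightarrow> real"
  where "X kph k = (if kph \<in> P then sqrt (1 - (b k)\<^sup>2) else 1)"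

definition Y :: "real ^ 3 \<Rightarrow> real ^ 3 \<Rightarrow> real"
  where "Y kph k = (if kph \<in> P \<and> k \<notin> K then b k else 0)"

text \<open>The sign opposite to that of the charge makes the interaction energy nonpositive for
  either sign of \<open>q\<close>.\<close>

definition Z :: "real ^ 3 \<Rightarrow> real ^ 3 \<Rightarrow> real"
  where "Z kph k = (if kph \<in> P \<and> k \<in> K then - sgn q * b k else 0)"

text \<open>The photon amplitudes are the coordinates of \<open>u kph\<close> in the polarization
  basis, so the emitted photon is polarized along \<open>u kph\<close> whatever that basis
  is.\<close>

definition trial_wave :: wave
  where "trial_wave kph k = trial_state (X kph k) (Y kph k)
    (Z kph k * (\<epsilon>H kph \<bullet> u kph)) (Z kph k * (\<epsilon>V kph \<bullet> u kph))"

lemma P_bounds: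
  assumes "p \<in> P"
  shows "\<bar>p $ 3\<bar> < p $ 1" "p \<noteq> 0" "norm p < 3 / 2 * d"
proof -
  have n: "norm (p - d *\<^sub>R axis 1 1) < d / 2"
    using assms by (simp add: P_def dist_norm norm_minus_commute)
  have "\<bar>p $ 3\<bar> < d / 2" "\<bar>p $ 1 - d\<bar> < d / 2"
    using component_le_norm_cart[of "p - d *\<^sub>R axis 1 1" 3]
      component_le_norm_cart[of "p - d *\<^sub>R axis 1 1" 1] n by (simp_all add: axis_def)
  then show 1: "\<bar>p $ 3\<bar> < p $ 1" by linarith
  then show "p \<noteq> 0" by auto
  have "norm p \<le> norm (p - d *\<^sub>R axis 1 1) + norm (d *\<^sub>R axis 1 1 :: real ^ 3)"
    using norm_triangle_ineq[of "p - d *\<^sub>R axis 1 1" "d *\<^sub>R axis 1 1"] by simp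
  with n d_pos show "norm p < 3 / 2 * d" by simp
qed

text \<open>On \<open>P\<close> the vector \<open>u p\<close> is a unit vector orthogonal to
  \<open>p\<close>, hence lies in the plane spanned by the two polarization vectors.\<close>

lemma u_expansion:
  assumes "p \<in> P"
  shows "(\<epsilon>H p \<bullet> u p) *\<^sub>R \<epsilon>H p + (\<epsilon>V p \<bullet> u p) *\<^sub>R \<epsilon>V p = u p"
    and "(\<epsilon>H p \<bullet> u p)\<^sup>2 + (\<epsilon>V p \<bullet> u p)\<^sup>2 = 1"
    and "norm (u p) = 1"
proof -
  note p = P_bounds[OF assms]
  have "transverse p \<noteq> 0" using norm_transverse_ge[OF p(1)] by auto
  then show n: "norm (u p) = 1" by (simp add: u_def norm_sgn)
  have "u p \<bullet> p = 0"
    using transverse_inner[OF p(2)] by (simp add: u_def sgn_div_norm)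
  then show e: "(\<epsilon>H p \<bullet> u p) *\<^sub>R \<epsilon>H p + (\<epsilon>V p \<bullet> u p) *\<^sub>R \<epsilon>V p = u p"
    using pol p(2) by (intro orthonormal_pair_expansion[of _ _ p]) (auto simp: polarization_def)
  have "((\<epsilon>H p \<bullet> u p) *\<^sub>R \<epsilon>H p + (\<epsilon>V p \<bullet> u p) *\<^sub>R \<epsilon>V p) \<bullet> u p = 1"
    unfolding e using n by (simp add: dot_square_norm)
  then show "(\<epsilon>H p \<bullet> u p)\<^sup>2 + (\<epsilon>V p \<bullet> u p)\<^sup>2 = 1"
    by (simp add: inner_add_left power2_eq_square)
qed

lemma b_sq: "(b k)\<^sup>2 \<le> 1 / 4"
  using power_mono[OF b_le less_imp_le[OF b_pos], of k 2] by (simp add: power_divide)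

lemma Z_sq: "(Z kph k * (\<epsilon>H kph \<bullet> u kph))\<^sup>2 + (Z kph k * (\<epsilon>V kph \<bullet> u kph))\<^sup>2 =
    (if kph \<in> P \<and> k \<in> K then (b k)\<^sup>2 else 0)"
proof -
  have "(sgn q)\<^sup>2 = 1" using pos by (simp add: sgn_if power2_eq_square)
  then have "kph \<in> P \<Longrightarrow> (Z kph k)\<^sup>2 = (if kph \<in> P \<and> k \<in> K then (b k)\<^sup>2 else 0)"
    by (simp add: Z_def power_mult_distrib)
  moreover have "(Z kph k * (\<epsilon>H kph \<bullet> u kph))\<^sup>2 + (Z kph k * (\<epsilon>V kph \<bullet> u kph))\<^sup>2 =
      (Z kph k)\<^sup>2 * ((\<epsilon>H kph \<bullet> u kph)\<^sup>2 + (\<epsilon>V kph \<bullet> u kph)\<^sup>2)"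
    by (simp add: power_mult_distrib distrib_left)
  ultimately show ?thesis using u_expansion(2)[of kph] by (auto simp: Z_def)
qed

lemma Y_sq: "(Y kph k)\<^sup>2 = (if kph \<in> P \<and> k \<notin> K then (b k)\<^sup>2 else 0)"
  by (simp add: Y_def)

lemma properly_normalized_trial_wave: "properly_normalized trial_wave"
proof -
  have "(X kph k)\<^sup>2 + (Y kph k)\<^sup>2 + (Z kph k * (\<epsilon>H kph \<bullet> u kph))\<^sup>2 + (Z kph k * (\<epsilon>V kph \<bullet> u kph))\<^sup>2 = 1" for kph k
    using Z_sq[of kph k] Y_sq[of kph k] b_sq[of k] by (auto simp: X_def)
  then show ?thesis
    by (simp add: properly_normalized_def trial_wave_def fock_norm_trial_state)
qed

lemma amplitude_measurable [measurable (raw)]: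
  assumes [measurable]: "f \<in> borel_measurable M" "g \<in> borel_measurable M"
  shows "(\<lambda>z. X (f z) (g z)) \<in> borel_measurable M" "(\<lambda>z. Y (f z) (g z)) \<in> borel_measurable M"
    "(\<lambda>z. Z (f z) (g z)) \<in> borel_measurable M"
  unfolding X_def Y_def Z_def by measurable

lemma wave_function_trial_wave: "wave_function trial_wave"
  unfolding wave_function_def
proof (intro conjI allI)
  fix kph k
  show "trial_wave kph k \<in> fock_space"
    unfolding trial_wave_def by (rule finite_photon_number_in_fock_space[of 1]) simp
next
  fix p :: "nat \<times> nat"
  have [measurable]: "\<epsilon>H \<in> borel_measurable borel" "\<epsilon>V \<in> borel_measurable borel"
    using pol by (simp_all add: polarization_def)
  show "(\<lambda>z. trial_wave (fst z) (snd z) p) \<in> borel_measurable borel"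
    unfolding trial_wave_def trial_state_def borel_prod[symmetric]
    by (cases "p = (0, 0)"; cases "p = (1, 0)"; cases "p = (0, 1)") simp_all
qed

section \<open>Pointwise energy densities of the trial wave\<close>

lemma H_el_trial_wave:
  "fock_inner (trial_wave kph k) (H_el hbar c \<kappa> trial_wave kph k) =
    complex_of_real (indicator P kph * (2 * hbar * omega c \<kappa> k * (b k)\<^sup>2))"
proof -
  have "fock_inner (trial_wave kph k) (H_el hbar c \<kappa> trial_wave kph k) =
    complex_of_real (2 * hbar * omega c \<kappa> k * ((Y kph k)\<^sup>2 + ((Z kph k * (\<epsilon>H kph \<bullet> u kph))\<^sup>2 + (Z kph k * (\<epsilon>V kph \<bullet> u kph))\<^sup>2)))"
    by (simp add: trial_wave_def fock_inner_trial_state H_el_nth axis_def pair_neq power2_eq_square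
        scaleR_conv_of_real[where 'a=complex])
      (simp add: algebra_simps)
  \<comment> \<open>The supports of \<open>Y\<close> and \<open>Z\<close> split \<open>P\<close>
    along \<open>K\<close>, so the pair probability is \<open>b\<close> squared throughout; the
    factor 2 counts the particles in a pair.\<close>
  then show ?thesis
    unfolding Z_sq Y_sq by (auto simp: indicator_def)
qed

lemma H_ph_trial_wave:
  "fock_inner (trial_wave kph k) (H_ph hbar c trial_wave kph k) =
    complex_of_real (indicator P kph * indicator K k * (hbar * c * norm kph * (b k)\<^sup>2))"
proof -
  have "fock_inner (trial_wave kph k) (H_ph hbar c trial_wave kph k) =
    complex_of_real (hbar * c * norm kph * ((Z kph k * (\<epsilon>H kph \<bullet> u kph))\<^sup>2 + (Z kph k * (\<epsilon>V kph \<bullet> u kph))\<^sup>2))"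
    by (simp add: trial_wave_def fock_inner_trial_state H_ph_nth axis_def power2_eq_square
        scaleR_conv_of_real[where 'a=complex])
      (simp add: algebra_simps)
  then show ?thesis
    unfolding Z_sq by (auto simp: indicator_def)
qed

text \<open>The negative of the interaction energy density. Its two summands belong to the pair
  component at the partner \<open>- kph - k\<close> and at \<open>k\<close> itself.\<close>

definition gain :: "real ^ 3 \<Rightarrow> real ^ 3 \<Rightarrow> real"
  where "gain kph k = indicator P kph * (\<bar>q\<bar> * c * (lam / 2) *
    (pair_current c \<kappa> k (- kph - k) \<bullet> u kph) *
    (X kph k * (indicator K (- kph - k) * b (- kph - k)) + X kph (- kph - k) * (indicator K k * b k)))"

lemma H_I_trial_wave:
  "fock_inner (trial_wave kph k) (H_I q c \<kappa> lam \<epsilon>H \<epsilon>V trial_wave kph k) = complex_of_real (- gain kph k)"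
proof -
  \<comment> \<open>The two polarization amplitudes recombine into a multiple of
    \<open>u kph\<close>, which removes the polarization vectors from the energy.\<close>
  have e: "(z * (\<epsilon>H kph \<bullet> u kph)) *\<^sub>R \<epsilon>H kph + (z * (\<epsilon>V kph \<bullet> u kph)) *\<^sub>R \<epsilon>V kph = z *\<^sub>R u kph"
    if "kph \<in> P" for z
    using arg_cong[OF u_expansion(1)[OF that], of "\<lambda>v. z *\<^sub>R v"] by (simp add: scaleR_add_right)
  have s: "q * sgn q = \<bar>q\<bar>" by (simp add: abs_sgn)
  have "fock_inner (trial_wave kph k) (H_I q c \<kappa> lam \<epsilon>H \<epsilon>V trial_wave kph k) = complex_of_real
    (q * c * (lam / 2) * (pair_current c \<kappa> k (- kph - k) \<bullet>
      (X kph k *\<^sub>R ((Z kph (- kph - k) * (\<epsilon>H kph \<bullet> u kph)) *\<^sub>R \<epsilon>H kph + (Z kph (- kph - k) * (\<epsilon>V kph \<bullet> u kph)) *\<^sub>R \<epsilon>V kph) +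
       X kph (- kph - k) *\<^sub>R ((Z kph k * (\<epsilon>H kph \<bullet> u kph)) *\<^sub>R \<epsilon>H kph + (Z kph k * (\<epsilon>V kph \<bullet> u kph)) *\<^sub>R \<epsilon>V kph))))"
    using fock_inner_H_I[where x = X and y = Y and h = "\<lambda>kph k. Z kph k * (\<epsilon>H kph \<bullet> u kph)"
        and v = "\<lambda>kph k. Z kph k * (\<epsilon>V kph \<bullet> u kph)"]
    by (simp add: trial_wave_def[abs_def])
  also have "\<dots> = complex_of_real (- gain kph k)"
  proof (cases "kph \<in> P")
    case True
    have Z: "Z kph k = - sgn q * (indicator K k * b k)" for k
      using True by (simp add: Z_def indicator_def)
    show ?thesis
      unfolding e[OF True] Z gain_def s[symmetric] using True
      by (simp add: inner_add_right algebra_simps)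
  qed (simp add: Z_def gain_def)
  finally show ?thesis .
qed

lemma X_bounds: "1 / 2 \<le> X kph k" "X kph k \<le> 1"
proof -
  have "1 / 2 \<le> sqrt (1 - (b k)\<^sup>2)"
    using b_sq[of k] by (intro real_le_rsqrt) (simp add: power_divide)
  then show "1 / 2 \<le> X kph k" "X kph k \<le> 1"
    by (simp_all add: X_def)
qed

text \<open>The bound on \<open>norm k\<close> confines the support for integrability. The upper
  bound combines the current bound 10 with amplitude products summing to at most 1. The constant
  1/24 is the product of 1/2 from the field, 1/6 from the current and 1/2 from the vacuum
  amplitude.\<close>

lemma gain_cases:
  obtains "gain kph k = 0" "\<not> (kph \<in> P \<and> k \<in> K)"
  | "kph \<in> P" "norm k < \<kappa>" "0 \<le> gain kph k" "gain kph k \<le> \<bar>q\<bar> * c * (lam / 2) * 10"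
    "k \<in> K \<Longrightarrow> \<bar>q\<bar> * c * lam / 24 * b k \<le> gain kph k"
proof (cases "kph \<in> P \<and> (k \<in> K \<or> - kph - k \<in> K)")
  case False
  then have "gain kph k = 0" by (auto simp: gain_def indicator_def)
  then show ?thesis using False that(1) by blast
next
  case True
  then have kph: "kph \<in> P" by simp
  let ?k' = "- kph - k" and ?c = "\<bar>q\<bar> * c * (lam / 2)"
  define j where "j = pair_current c \<kappa> k ?k' \<bullet> u kph"
  define S1 where "S1 = X kph k * (indicator K ?k' * b ?k')"
  define S2 where "S2 = X kph ?k' * (indicator K k * b k)"
  have g: "gain kph k = ?c * j * (S1 + S2)"
    using kph by (simp add: gain_def j_def S1_def S2_def)
  have c0: "0 < ?c" using pos by simp
  \<comment> \<open>One of the two wave vectors lies in \<open>K\<close>, and their norms differ by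
    at most \<open>norm kph\<close>; both therefore stay below 5/2 of \<open>d\<close>, that is 5/16
    of \<open>\<kappa>\<close>.\<close>
  have "norm k < d \<or> norm ?k' < d" using True by (auto simp: K_def)
  moreover have "norm ?k' \<le> norm kph + norm k" using norm_triangle_ineq4[of "- kph" k] by simp
  moreover have "norm k \<le> norm kph + norm ?k'" using norm_triangle_ineq4[of "- kph" ?k'] by simp
  ultimately have k: "norm k \<le> \<kappa> / 2" "norm ?k' \<le> \<kappa> / 2"
    using P_bounds(3)[OF kph] d_pos d by auto
  note J = pair_current_bounds[OF pos(2,3) k]
  have "1 / 6 \<le> j" using J(2)[OF P_bounds(1)[OF kph]] by (simp add: j_def u_def)
  moreover have "j \<le> 10 * 1"
    unfolding j_def using J(1) u_expansion(3)[OF kph]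
    by (intro order_trans[OF norm_cauchy_schwarz mult_mono]) auto
  ultimately have j: "1 / 6 \<le> j" "j \<le> 10" by simp_all
  have ib: "0 \<le> indicator K k * b k" "indicator K k * b k \<le> 1 / 2" for k
    using b_pos[of k] b_le[of k] by (auto simp: indicator_def)
  have xb: "0 \<le> X kph k1 * (indicator K k2 * b k2)" "X kph k1 * (indicator K k2 * b k2) \<le> 1 / 2" for k1 k2
    using ib[of k2] X_bounds[of kph k1] mult_mono[OF X_bounds(2)[of kph k1] ib(2)[of k2]] by auto
  have S: "0 \<le> S1" "0 \<le> S2" "S1 + S2 \<le> 1"
    using xb[of k ?k'] xb[of ?k' k] by (simp_all add: S1_def S2_def)
  show ?thesis
  proof (rule that(2))
    show "kph \<in> P" by (rule kph)
    show "norm k < \<kappa>" using k(1) pos(3) by simp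
    show "0 \<le> gain kph k" unfolding g using c0 j S by simp
    have "j * (S1 + S2) \<le> 10 * 1" using j S by (intro mult_mono) auto
    then show "gain kph k \<le> ?c * 10"
      unfolding g mult.assoc[of ?c] using c0 by (intro mult_left_mono) auto
    assume "k \<in> K"
    then have "b k * (1 / 2) \<le> S1 + S2"
      using S(1) b_pos[of k] X_bounds(1)[of kph ?k'] by (simp add: S2_def add_increasing)
    then have "1 / 6 * (b k * (1 / 2)) \<le> j * (S1 + S2)"
      using j S b_pos[of k] by (intro mult_mono) auto
    from mult_left_mono[OF this less_imp_le[OF c0]]
    show "\<bar>q\<bar> * c * lam / 24 * b k \<le> gain kph k"
      unfolding g by (simp add: ac_simps)
  qed
qed

definition energy :: "(real ^ 3) \<times> (real ^ 3) \<Rightarrow> real"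
  where "energy = (\<lambda>(kph, k). indicator P kph * indicator K k * (hbar * c * norm kph * (b k)\<^sup>2) - gain kph k)"

text \<open>On \<open>P\<close> and \<open>K\<close> the photon energy is quadratic in
  \<open>b k\<close> and \<open>b_small\<close> puts it below the linear lower bound for
  \<open>gain\<close>. Elsewhere only the nonnegative \<open>gain\<close> is subtracted.\<close>

lemma energy_neg:
  "energy (kph, k) \<le> 0"
  "kph \<in> P \<Longrightarrow> k \<in> K \<Longrightarrow> energy (kph, k) < 0"
proof -
  show 2: "energy (kph, k) < 0" if "kph \<in> P" "k \<in> K"
  proof -
    have "norm kph * (hbar * b k) \<le> 3 / 2 * d * (hbar * b k)"
      using P_bounds(3)[OF that(1)] pos b_pos[of k] by (intro mult_right_mono) auto
    then have "hbar * norm kph * b k < \<bar>q\<bar> * lam / 24"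
      using b_small[of k] by (simp add: ac_simps)
    then have "(c * b k) * (hbar * norm kph * b k) < (c * b k) * (\<bar>q\<bar> * lam / 24)"
      using pos b_pos[of k] by (intro mult_strict_left_mono) auto
    also have "\<dots> \<le> gain kph k"
      using that by (cases rule: gain_cases[of kph k]) (auto simp: ac_simps)
    finally show ?thesis
      using that by (simp add: energy_def power2_eq_square ac_simps)
  qed
  show "energy (kph, k) \<le> 0"
  proof (cases "kph \<in> P \<and> k \<in> K")
    case False
    then have "energy (kph, k) = - gain kph k" by (auto simp: energy_def)
    then show ?thesis by (cases rule: gain_cases[of kph k]) auto
  qed (use 2 in force)
qed

section \<open>Integration over the wave vectors\<close>

lemma integrable_energy:
  "integrable (lborel \<Otimes>\<^sub>M lborel) (\<lambda>(kph, k). indicator P kph * indicator K k * (hbar * c * norm kph * (b k)\<^sup>2))"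
  "integrable (lborel \<Otimes>\<^sub>M lborel) (\<lambda>(kph, k). gain kph k)"
proof -
  \<comment> \<open>The radius is \<open>\<kappa>\<close> and not \<open>d\<close>, because
    \<open>gain\<close> is also nonzero where only the partner wave vector lies in
    \<open>K\<close>.\<close>
  let ?A = "P \<times> ball 0 \<kappa> :: ((real ^ 3) \<times> (real ^ 3)) set"
  have A: "?A \<in> sets (lborel \<Otimes>\<^sub>M lborel)" by simp
  have fin: "emeasure (lborel \<Otimes>\<^sub>M lborel) ?A < \<infinity>"
    using emeasure_lborel_ball_finite[of "d *\<^sub>R axis 1 1 :: real ^ 3" "d / 2"]
      emeasure_lborel_ball_finite[of "0 :: real ^ 3" \<kappa>]
    by (simp add: lborel.emeasure_pair_measure_Times P_def ennreal_mult_less_top)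
  show "integrable (lborel \<Otimes>\<^sub>M lborel) (\<lambda>(kph, k). indicator P kph * indicator K k * (hbar * c * norm kph * (b k)\<^sup>2))"
  proof (rule integrableI_bounded_set[OF A _ fin, where B = "hbar * c * (2 * d)"])
    show "AE x in lborel \<Otimes>\<^sub>M lborel. x \<in> ?A \<longrightarrow> norm (case x of (kph, k) \<Rightarrow>
        indicator P kph * indicator K k * (hbar * c * norm kph * (b k)\<^sup>2)) \<le> hbar * c * (2 * d)"
    proof (intro AE_I2 impI, clarify)
      fix p k :: "real ^ 3" assume p: "p \<in> P"
      have "norm p * (b k)\<^sup>2 \<le> 2 * d * 1"
        using P_bounds(3)[OF p] b_sq[of k] d_pos by (intro mult_mono) auto
      then have "hbar * c * (norm p * (b k)\<^sup>2) \<le> hbar * c * (2 * d)"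
        using pos by (intro mult_left_mono) auto
      then show "norm (indicator P p * indicator K k * (hbar * c * norm p * (b k)\<^sup>2)) \<le> hbar * c * (2 * d)"
        using pos d_pos p by (auto simp: indicator_def abs_mult ac_simps)
    qed
    show "AE x in lborel \<Otimes>\<^sub>M lborel. x \<notin> ?A \<longrightarrow> (case x of (kph, k) \<Rightarrow>
        indicator P kph * indicator K k * (hbar * c * norm kph * (b k)\<^sup>2)) = 0"
      using d pos by (intro AE_I2) (auto simp: indicator_def K_def)
  qed measurable
  show "integrable (lborel \<Otimes>\<^sub>M lborel) (\<lambda>(kph, k). gain kph k)"
  proof (rule integrableI_bounded_set[OF A _ fin, where B = "\<bar>q\<bar> * c * (lam / 2) * 10"])
    show "AE x in lborel \<Otimes>\<^sub>M lborel. x \<in> ?A \<longrightarrow>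
        norm (case x of (kph, k) \<Rightarrow> gain kph k) \<le> \<bar>q\<bar> * c * (lam / 2) * 10"
    proof (intro AE_I2 impI)
      fix z :: "(real ^ 3) \<times> (real ^ 3)"
      show "norm (case z of (kph, k) \<Rightarrow> gain kph k) \<le> \<bar>q\<bar> * c * (lam / 2) * 10"
        using pos by (cases rule: gain_cases[of "fst z" "snd z"]) (auto simp: case_prod_unfold)
    qed
    show "AE x in lborel \<Otimes>\<^sub>M lborel. x \<notin> ?A \<longrightarrow> (case x of (kph, k) \<Rightarrow> gain kph k) = 0"
    proof (intro AE_I2 impI)
      fix z :: "(real ^ 3) \<times> (real ^ 3)" assume "z \<notin> ?A"
      then show "(case z of (kph, k) \<Rightarrow> gain kph k) = 0"
        by (cases rule: gain_cases[of "fst z" "snd z"]) (auto simp: case_prod_unfold mem_Times_iff)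
    qed
  qed (unfold gain_def, measurable)
qed

lemma expectation_defined_trial_wave:
  "expectation_defined (H_ph hbar c) trial_wave"
  "expectation_defined (H_I q c \<kappa> lam \<epsilon>H \<epsilon>V) trial_wave"
proof -
  have "H_ph hbar c trial_wave kph k \<in> fock_space" for kph k
    by (rule finite_photon_number_in_fock_space[of 1]) (simp add: H_ph_nth trial_wave_def)
  then show "expectation_defined (H_ph hbar c) trial_wave"
    using integrable_of_real[OF integrable_energy(1)]
    by (simp add: expectation_defined_def H_ph_trial_wave case_prod_unfold)
  have "H_I q c \<kappa> lam \<epsilon>H \<epsilon>V trial_wave kph k \<in> fock_space" for kph k
    unfolding trial_wave_def[abs_def] by (rule H_I_in_fock_space)
  then show "expectation_defined (H_I q c \<kappa> lam \<epsilon>H \<epsilon>V) trial_wave"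
    using integrable_of_real[OF integrable_energy(2)]
    by (simp add: expectation_defined_def H_I_trial_wave case_prod_unfold)
qed

text \<open>Fubini's theorem turns the iterated integral into one over the product space, where
  photon and interaction energies can be added pointwise.\<close>

lemma expectation_real:
  assumes "\<And>kph k. fock_inner (trial_wave kph k) (H trial_wave kph k) = complex_of_real (f kph k)"
    and "integrable (lborel \<Otimes>\<^sub>M lborel) (\<lambda>(kph, k). f kph k)"
  shows "expectation l H trial_wave =
    complex_of_real (l ^ 6 * (\<integral>z. (case z of (kph, k) \<Rightarrow> f kph k) \<partial>(lborel \<Otimes>\<^sub>M lborel)))"
  using lborel_pair.integral_fst'[OF assms(2)]
  by (simp add: expectation_def assms(1))

lemma expectation_neg:
  assumes "0 < l"
  shows "\<exists>E < 0. expectation l (H_ph hbar c) trial_wave +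
    expectation l (H_I q c \<kappa> lam \<epsilon>H \<epsilon>V) trial_wave = complex_of_real E"
proof -
  have i: "integrable (lborel \<Otimes>\<^sub>M lborel) energy"
    using Bochner_Integration.integrable_diff[OF integrable_energy] by (simp add: energy_def case_prod_unfold)
  have "emeasure (lborel \<Otimes>\<^sub>M lborel) (P \<times> K) = emeasure lborel P * emeasure lborel K"
    by (rule lborel.emeasure_pair_measure_Times) simp_all
  moreover have "emeasure lborel (ball a r) \<noteq> 0" if "0 < r" for a :: "real ^ 3" and r
    using content_ball_pos[OF that, of a] by (auto simp: measure_def)
  ultimately have "emeasure (lborel \<Otimes>\<^sub>M lborel) (P \<times> K) \<noteq> 0"
    using d_pos by (simp add: P_def K_def)
  then have neg: "lebesgue_integral (lborel \<Otimes>\<^sub>M lborel) energy < 0"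
    using energy_neg by (intro integral_neg[OF i, where A = "P \<times> K"]) auto
  have "lebesgue_integral (lborel \<Otimes>\<^sub>M lborel) energy =
      (\<integral>z. (case z of (kph, k) \<Rightarrow> indicator P kph * indicator K k * (hbar * c * norm kph * (b k)\<^sup>2)) \<partial>(lborel \<Otimes>\<^sub>M lborel)) +
      (\<integral>z. (case z of (kph, k) \<Rightarrow> - gain kph k) \<partial>(lborel \<Otimes>\<^sub>M lborel))"
    using Bochner_Integration.integral_diff[OF integrable_energy]
    by (simp add: energy_def case_prod_unfold)
  moreover have "integrable (lborel \<Otimes>\<^sub>M lborel) (\<lambda>(kph, k). - gain kph k)"
    using integrable_energy(2) by (simp add: case_prod_unfold)
  note expectation_real[where H = "H_I q c \<kappa> lam \<epsilon>H \<epsilon>V" and l = l, OF H_I_trial_wave this]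
    expectation_real[where H = "H_ph hbar c" and l = l, OF H_ph_trial_wave integrable_energy(1)]
  ultimately have "expectation l (H_ph hbar c) trial_wave +
      expectation l (H_I q c \<kappa> lam \<epsilon>H \<epsilon>V) trial_wave =
      complex_of_real (l ^ 6 * lebesgue_integral (lborel \<Otimes>\<^sub>M lborel) energy)"
    by (simp add: distrib_left)
  moreover have "l ^ 6 * lebesgue_integral (lborel \<Otimes>\<^sub>M lborel) energy < 0"
    using neg assms by (simp add: mult_pos_neg)
  ultimately show ?thesis by blast
qed

lemma electron_energy:
  "integrable lborel (\<lambda>kph. fock_inner (trial_wave kph k) (H_el hbar c \<kappa> trial_wave kph k))"
  "(\<integral>kph. fock_inner (trial_wave kph k) (H_el hbar c \<kappa> trial_wave kph k) \<partial>lborel) =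
    complex_of_real (measure lborel P * (2 * hbar * omega c \<kappa> k * (b k)\<^sup>2))"
proof -
  have P: "emeasure lborel P < \<infinity>" unfolding P_def by (rule emeasure_lborel_ball_finite)
  have "integrable lborel (\<lambda>kph. indicator P kph * (2 * hbar * omega c \<kappa> k * (b k)\<^sup>2))"
    using P by simp
  then show "integrable lborel (\<lambda>kph. fock_inner (trial_wave kph k) (H_el hbar c \<kappa> trial_wave kph k))"
    unfolding H_el_trial_wave by (rule integrable_of_real)
  show "(\<integral>kph. fock_inner (trial_wave kph k) (H_el hbar c \<kappa> trial_wave kph k) \<partial>lborel) =
    complex_of_real (measure lborel P * (2 * hbar * omega c \<kappa> k * (b k)\<^sup>2))"
    unfolding H_el_trial_wave integral_complex_of_real using P by simp
qed

end

text \<open>The electron energy of the trial wave at \<open>k\<close> is proportional to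
  \<open>b k\<close> squared, so the prescribed density determines \<open>b\<close>. The threshold
  \<open>r0\<close> is the density at which \<open>b\<close> reaches the largest admissible
  amplitude \<open>\<tau>\<close>.\<close>

theorem theorem3p2:
  fixes hbar c \<kappa> l lam q \<sigma> :: real
  assumes "hbar > 0" and "c > 0" and "\<kappa> > 0" and "l > 0" and "lam > 0" and "q \<noteq> 0" and "\<sigma> > 0"
  shows "\<exists>r0 > 0. \<forall>\<epsilon>H \<epsilon>V :: real ^ 3 \<Rightarrow> real ^ 3. \<forall>\<rho>0 :: real.
    polarization \<epsilon>H \<epsilon>V \<and> 0 < \<rho>0 \<and> \<rho>0 \<le> r0 \<longrightarrow>
    (let \<rho> = (\<lambda>k :: real ^ 3. \<rho>0 * exp (- (norm k)\<^sup>2 / (2 * \<sigma>\<^sup>2)))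
     in \<exists>\<psi>. wave_function \<psi> \<and> properly_normalized \<psi> \<and>
          expectation_defined (H_ph hbar c) \<psi> \<and>
          expectation_defined (H_I q c \<kappa> lam \<epsilon>H \<epsilon>V) \<psi> \<and>
          (\<exists>E < 0. expectation l (H_ph hbar c) \<psi> + expectation l (H_I q c \<kappa> lam \<epsilon>H \<epsilon>V) \<psi> =
             complex_of_real E) \<and>
          (\<forall>k. integrable lborel (\<lambda>kph. fock_inner (\<psi> kph k) (H_el hbar c \<kappa> \<psi> kph k)) \<and>
             complex_of_real (l ^ 3) *
               (\<integral>kph. fock_inner (\<psi> kph k) (H_el hbar c \<kappa> \<psi> kph k) \<partial>lborel) =
             complex_of_real (\<rho> k * hbar * omega c \<kappa> k)))"
proof -
  define d where "d = \<kappa> / 8"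
  define V where "V = measure lborel (ball (d *\<^sub>R axis 1 1 :: real ^ 3) (d / 2))"
  \<comment> \<open>The second bound gives a photon cost of at most 1/32 of
    \<open>\<bar>q\<bar> * lam\<close>, strictly below the 1/24 required by
    \<open>b_small\<close>.\<close>
  define \<tau> where "\<tau> = min (1 / 2) (\<bar>q\<bar> * lam / (48 * hbar * d))"
  define r0 where "r0 = 2 * l ^ 3 * V * \<tau>\<^sup>2"
  have d: "0 < d" using assms by (simp add: d_def)
  have V: "0 < V" using d by (simp add: V_def content_ball_pos)
  have \<tau>: "0 < \<tau>" "\<tau> \<le> 1 / 2" "\<tau> \<le> \<bar>q\<bar> * lam / (48 * hbar * d)"
    using assms d by (simp_all add: \<tau>_def)
  have "hbar * (3 / 2 * d) * \<tau> \<le> hbar * (3 / 2 * d) * (\<bar>q\<bar> * lam / (48 * hbar * d))"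
    using \<tau>(3) assms d by (intro mult_left_mono) auto
  also have "\<dots> < \<bar>q\<bar> * lam / 24"
    using assms d by (simp add: field_simps)
  finally have \<tau>_small: "hbar * (3 / 2 * d) * \<tau> < \<bar>q\<bar> * lam / 24" .
  show ?thesis
  proof (intro exI[of _ r0] conjI allI impI)
    show "0 < r0" using assms V \<tau> by (simp add: r0_def)
    fix \<epsilon>H \<epsilon>V :: "real ^ 3 \<Rightarrow> real ^ 3" and \<rho>0 :: real
    assume *: "polarization \<epsilon>H \<epsilon>V \<and> 0 < \<rho>0 \<and> \<rho>0 \<le> r0"
    define \<rho> where "\<rho> = (\<lambda>k :: real ^ 3. \<rho>0 * exp (- (norm k)\<^sup>2 / (2 * \<sigma>\<^sup>2)))"
    \<comment> \<open>Solves \<open>2 * l ^ 3 * V * (b k)\<^sup>2 = \<rho> k\<close>, where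
      \<open>V\<close> is the volume of \<open>P\<close> and 2 the number of particles in a
      pair.\<close>
    define b where "b k = sqrt (\<rho> k / (2 * l ^ 3 * V))" for k
    have \<rho>: "0 < \<rho> k" "\<rho> k \<le> r0" for k
    proof -
      show "0 < \<rho> k" using * by (simp add: \<rho>_def)
      have "\<rho>0 * exp (- (norm k)\<^sup>2 / (2 * \<sigma>\<^sup>2)) \<le> \<rho>0 * 1"
        using * by (intro mult_left_mono) auto
      also have "\<dots> \<le> r0" using * by simp
      finally show "\<rho> k \<le> r0" by (simp only: \<rho>_def)
    qed
    have b_square: "(b k)\<^sup>2 = \<rho> k / (2 * l ^ 3 * V)" for k
      using \<rho>(1)[of k] assms V by (simp add: b_def)
    have b_pos: "0 < b k" for k
      using \<rho>(1)[of k] assms V by (simp add: b_def)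
    have b_le: "b k \<le> \<tau>" for k
    proof -
      have "\<rho> k / (2 * l ^ 3 * V) \<le> r0 / (2 * l ^ 3 * V)"
        using \<rho>(2) assms V by (intro divide_right_mono) auto
      also have "\<dots> = \<tau>\<^sup>2"
        using assms V by (simp add: r0_def)
      finally show ?thesis
        using \<tau>(1) unfolding b_def by (intro real_le_lsqrt) auto
    qed
    interpret pair_trial hbar c \<kappa> lam q d \<epsilon>H \<epsilon>V b
    proof
      show "b \<in> borel_measurable borel"
        unfolding b_def[abs_def] \<rho>_def by measurable
      show "hbar * (3 / 2 * d) * b k < \<bar>q\<bar> * lam / 24" for k
        by (rule le_less_trans[OF mult_left_mono[OF b_le] \<tau>_small]) (use assms d in simp)
      show "b k \<le> 1 / 2" for k using b_le[of k] \<tau>(2) by simp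
    qed (use assms * b_pos in \<open>simp_all add: d_def\<close>)
    have "complex_of_real (l ^ 3) *
        (\<integral>kph. fock_inner (trial_wave kph k) (H_el hbar c \<kappa> trial_wave kph k) \<partial>lborel) =
        complex_of_real (\<rho> k * hbar * omega c \<kappa> k)" for k
    proof -
      have "l ^ 3 * (V * (2 * hbar * omega c \<kappa> k * (b k)\<^sup>2)) = \<rho> k * hbar * omega c \<kappa> k"
        unfolding b_square using assms V by (simp add: field_simps)
      then show ?thesis
        by (simp only: electron_energy(2) of_real_mult[symmetric] P_def V_def[symmetric])
    qed
    then show "let \<rho> = (\<lambda>k :: real ^ 3. \<rho>0 * exp (- (norm k)\<^sup>2 / (2 * \<sigma>\<^sup>2)))
     in \<exists>\<psi>. wave_function \<psi> \<and> properly_normalized \<psi> \<and>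
          expectation_defined (H_ph hbar c) \<psi> \<and>
          expectation_defined (H_I q c \<kappa> lam \<epsilon>H \<epsilon>V) \<psi> \<and>
          (\<exists>E < 0. expectation l (H_ph hbar c) \<psi> + expectation l (H_I q c \<kappa> lam \<epsilon>H \<epsilon>V) \<psi> =
             complex_of_real E) \<and>
          (\<forall>k. integrable lborel (\<lambda>kph. fock_inner (\<psi> kph k) (H_el hbar c \<kappa> \<psi> kph k)) \<and>
             complex_of_real (l ^ 3) *
               (\<integral>kph. fock_inner (\<psi> kph k) (H_el hbar c \<kappa> \<psi> kph k) \<partial>lborel) =
             complex_of_real (\<rho> k * hbar * omega c \<kappa> k))"
      unfolding Let_def \<rho>_def[symmetric]
      using wave_function_trial_wave properly_normalized_trial_wave expectation_defined_trial_wave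
        expectation_neg[OF assms(4)] electron_energy(1)
      by (intro exI[of _ trial_wave] conjI allI)
  qed
qed

end
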